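(* Let $R\subset S$ be an integral FCP extension of commutative rings. Then there exists a greatest subalgebra $V\in[R,S]$, denoted ${}^\square_SR$, such that $R\subseteq V$ is $\kappa$-separable. Moreover, for any $U\in[R,S]$, the extension $R\subseteq U$ is $\kappa$-separable if and only if $U\in[R,V]$; and any $Z\in[V,S]$ is such that $Z\subseteq S$ is $\kappa$-radicial.
   Context: All rings are commutative and unital; $\subset$ denotes proper inclusion. $[R,S]$ is the set of all $R$-subalgebras of $S$, ordered by inclusion; $R\subseteq S$ has FCP if each chain in $[R,S]$ is finite. For $Q\in\mathrm{Spec}(S)$ the residual extension of $R\subseteq S$ at $Q$ is $\kappa_R(Q\cap R)\to\kappa_S(Q)$, where $\kappa_R(P)=R_P/PR_P$. An integral extension is $\kappa$-separable (resp. $\kappa$-radicial) if all its residual extensions are separable algebraic (resp. purely inseparable) field extensions. *)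

theory Defs
  imports "HOL-Algebra.Finite_Extensions"
begin

section \<open>Ring extensions\<close>

text \<open>
  A ring extension \<open>R \<subseteq> S\<close> is given by a commutative ring \<open>S\<close> and a subset \<open>R\<close> of its carrier
  satisfying \<^term>\<open>subcring R S\<close>; an intermediate ring \<open>U\<close> is a subset too, and as a ring in its own
  right it is \<^term>\<open>S\<lparr>carrier := U\<rparr>\<close>.
\<close>

definition subalgebras :: "'a set \<Rightarrow> ('a, 'b) ring_scheme \<Rightarrow> 'a set set"
  where "subalgebras R S = {T. subcring T S \<and> R \<subseteq> T}"

definition FCP :: "'a set \<Rightarrow> ('a, 'b) ring_scheme \<Rightarrow> bool"
  where "FCP R S \<longleftrightarrow> (\<forall>C. subset.chain (subalgebras R S) C \<longrightarrow> finite C)"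

text \<open>
  Polynomials are coefficient lists, leading coefficient first. The predicate \<^const>\<open>polynomial\<close>
  is avoided below since it has no monic polynomials over the zero ring.
\<close>

definition integral_extension :: "'a set \<Rightarrow> ('a, 'b) ring_scheme \<Rightarrow> bool"
  where "integral_extension R S \<longleftrightarrow>
    (\<forall>x \<in> carrier S. \<exists>p. set p \<subseteq> R \<and> p \<noteq> [] \<and> lead_coeff p = \<one>\<^bsub>S\<^esub> \<and> ring.eval S p x = \<zero>\<^bsub>S\<^esub>)"


section \<open>Separable and purely inseparable field extensions\<close>

definition (in ring) poly_deriv :: "'a list \<Rightarrow> 'a list"
  where "poly_deriv p = normalize (map (\<lambda>i. [i] \<cdot> coeff p i) (rev [1..<length p]))"

definition separable_poly :: "('a, 'b) ring_scheme \<Rightarrow> 'a set \<Rightarrow> 'a list \<Rightarrow> bool"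
  where "separable_poly L K p \<longleftrightarrow>
    \<one>\<^bsub>K[X]\<^bsub>L\<^esub>\<^esub> gcdof\<^bsub>K[X]\<^bsub>L\<^esub>\<^esub> p (ring.poly_deriv L p)"

definition separable_algebraic :: "'a set \<Rightarrow> ('a, 'b) ring_scheme \<Rightarrow> bool"
  where "separable_algebraic K L \<longleftrightarrow>
    (\<forall>x \<in> carrier L. (ring.algebraic L over K) x \<and> separable_poly L K (ring.Irr L K x))"

text \<open>The additive order of \<open>\<one>\<close> is \<open>0\<close> if infinite, so it is the characteristic.\<close>

definition char_exponent :: "('a, 'b) ring_scheme \<Rightarrow> nat"
  where "char_exponent L =
    (let c = group.ord (add_monoid L) \<one>\<^bsub>L\<^esub> in if c = 0 then 1 else c)"

definition purely_inseparable :: "'a set \<Rightarrow> ('a, 'b) ring_scheme \<Rightarrow> bool"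
  where "purely_inseparable K L \<longleftrightarrow>
    (\<forall>x \<in> carrier L. \<exists>n::nat. x [^]\<^bsub>L\<^esub> (char_exponent L ^ n) \<in> K)"


section \<open>Localization at a prime and residue fields\<close>

definition fraction_rel :: "('a, 'b) ring_scheme \<Rightarrow> 'a set \<Rightarrow> (('a \<times> 'a) \<times> ('a \<times> 'a)) set"
  where "fraction_rel R P = {((a, s), (b, t)).
    a \<in> carrier R \<and> b \<in> carrier R \<and> s \<in> carrier R - P \<and> t \<in> carrier R - P \<and>
    (\<exists>u \<in> carrier R - P. u \<otimes>\<^bsub>R\<^esub> (a \<otimes>\<^bsub>R\<^esub> t \<ominus>\<^bsub>R\<^esub> b \<otimes>\<^bsub>R\<^esub> s) = \<zero>\<^bsub>R\<^esub>)}"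

definition fraction :: "('a, 'b) ring_scheme \<Rightarrow> 'a set \<Rightarrow> 'a \<Rightarrow> 'a \<Rightarrow> ('a \<times> 'a) set"
  where "fraction R P a s = fraction_rel R P `` {(a, s)}"

definition localization :: "('a, 'b) ring_scheme \<Rightarrow> 'a set \<Rightarrow> ('a \<times> 'a) set ring"
  where "localization R P =
    \<lparr>carrier = (carrier R \<times> (carrier R - P)) // fraction_rel R P,
     mult = (\<lambda>A B. \<Union>(a, s) \<in> A. \<Union>(b, t) \<in> B.
               fraction R P (a \<otimes>\<^bsub>R\<^esub> b) (s \<otimes>\<^bsub>R\<^esub> t)),
     one = fraction R P \<one>\<^bsub>R\<^esub> \<one>\<^bsub>R\<^esub>,
     zero = fraction R P \<zero>\<^bsub>R\<^esub> \<one>\<^bsub>R\<^esub>,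
     add = (\<lambda>A B. \<Union>(a, s) \<in> A. \<Union>(b, t) \<in> B.
               fraction R P (a \<otimes>\<^bsub>R\<^esub> t \<oplus>\<^bsub>R\<^esub> b \<otimes>\<^bsub>R\<^esub> s) (s \<otimes>\<^bsub>R\<^esub> t))\<rparr>"

definition localized_ideal :: "('a, 'b) ring_scheme \<Rightarrow> 'a set \<Rightarrow> ('a \<times> 'a) set set"
  where "localized_ideal R P = Idl\<^bsub>localization R P\<^esub> ((\<lambda>a. fraction R P a \<one>\<^bsub>R\<^esub>) ` P)"

definition residue_field :: "('a, 'b) ring_scheme \<Rightarrow> 'a set \<Rightarrow> ('a \<times> 'a) set set ring"
  where "residue_field R P = localization R P Quot localized_ideal R P"


section \<open>Residual extensions\<close>

text \<open>
  The map \<open>\<kappa>\<^sub>R(Q \<inter> R) \<rightarrow> \<kappa>\<^sub>S(Q)\<close> induced by the inclusion \<open>R \<subseteq> S\<close>: it sends the residue class of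
  \<open>a/s\<close> to the residue class of \<open>a/s\<close>. The members of \<^term>\<open>\<Union>A\<close> are the pairs \<open>(a, s)\<close> whose
  fraction lies in the residue class \<open>A\<close>, and all of them yield the same class in \<open>\<kappa>\<^sub>S(Q)\<close>.
\<close>

definition residual_map ::
    "('a, 'b) ring_scheme \<Rightarrow> 'a set \<Rightarrow> ('a \<times> 'a) set set \<Rightarrow> ('a \<times> 'a) set set"
  where "residual_map S Q A =
    (\<Union>(a, s) \<in> \<Union>A. localized_ideal S Q +>\<^bsub>localization S Q\<^esub> fraction S Q a s)"

definition residual_subfield :: "'a set \<Rightarrow> ('a, 'b) ring_scheme \<Rightarrow> 'a set \<Rightarrow> ('a \<times> 'a) set set set"
  where "residual_subfield R S Q =
    residual_map S Q ` carrier (residue_field (S\<lparr>carrier := R\<rparr>) (Q \<inter> R))"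

definition kappa_separable :: "'a set \<Rightarrow> ('a, 'b) ring_scheme \<Rightarrow> bool"
  where "kappa_separable R S \<longleftrightarrow> integral_extension R S \<and>
    (\<forall>Q. primeideal Q S \<longrightarrow> separable_algebraic (residual_subfield R S Q) (residue_field S Q))"

definition kappa_radicial :: "'a set \<Rightarrow> ('a, 'b) ring_scheme \<Rightarrow> bool"
  where "kappa_radicial R S \<longleftrightarrow> integral_extension R S \<and>
    (\<forall>Q. primeideal Q S \<longrightarrow> purely_inseparable (residual_subfield R S Q) (residue_field S Q))"

end

theory Submission
  imports Defs "HOL-Algebra.Generated_Fields" "HOL-Computational_Algebra.Primes"
begin

text \<open>
  An element \<open>x\<close> of a field is separable over a subfield \<open>K\<close> iff \<open>f(x) = 0 \<noteq> f'(x)\<close> for some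
  \<open>f\<close> over \<open>K\<close>. Clearing denominators, the residue of \<open>x \<in> S\<close> at a prime \<open>Q\<close> is separable over the
  residue field of \<open>R\<close> iff \<open>f(x) \<in> Q\<close> and \<open>f'(x) \<notin> Q\<close> for some \<open>f\<close> over \<open>R\<close>, a condition that does not
  change when \<open>S\<close> is replaced by an intermediate ring containing \<open>x\<close>. By lying over, the greatest
  \<open>\<kappa>\<close>-separable subalgebra \<open>V\<close> therefore consists of the elements satisfying it at every prime of \<open>S\<close>.

  For \<open>\<kappa>\<close>-radiciality, let \<open>x\<close> be a root of a monic polynomial of degree \<open>d\<close> over \<open>R\<close> and let \<open>p\<close> be the
  characteristic exponent at \<open>Q\<close>. The residue of \<open>x\<close> at any prime has degree at most \<open>d\<close>, so \<open>x\<close> is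
  separable at primes of residue characteristic \<open>0\<close> or greater than \<open>d\<close>, and \<open>x ^ (p ^ d)\<close> is
  separable at primes of residue characteristic \<open>p\<close>. Hence \<open>s x ^ (p ^ d) \<in> V\<close>, where \<open>s\<close> is the product
  of the integers up to \<open>d\<close> that are prime to \<open>p\<close>, and \<open>s\<close> is invertible in the residue field at \<open>Q\<close>.
\<close>


section \<open>Formal derivatives\<close>

lemma (in ring) subring_add_pow_closed:
  assumes "subring K R" "k \<in> K"
  shows "[(n::nat)] \<cdot> k \<in> K"
  using assms(2) subringE(2,7)[OF assms(1)] by (induction n) auto

lemma (in ring) subring_nat_pow_closed:
  assumes "subring K R" "k \<in> K"
  shows "k [^] (n::nat) \<in> K"
  using assms(2) subringE(3,6)[OF assms(1)] by (induction n) auto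

lemma (in ring) add_pow_eq_mult:
  "x \<in> carrier R \<Longrightarrow> [(n::nat)] \<cdot> x = [n] \<cdot> \<one> \<otimes> x"
  by (simp add: add_pow_ldistr)

lemma (in ring_hom_ring) hom_add_pow_nat:
  "x \<in> carrier R \<Longrightarrow> h ([(n::nat)] \<cdot>\<^bsub>R\<^esub> x) = [n] \<cdot>\<^bsub>S\<^esub> h x"
  by (induction n) auto

lemma (in cring) add_pow_cauchy_product:
  fixes a b :: "nat \<Rightarrow> 'a"
  assumes a: "\<And>k. a k \<in> carrier R" and b: "\<And>k. b k \<in> carrier R"
  shows "[Suc n] \<cdot> (\<Oplus>k\<in>{..Suc n}. a k \<otimes> b (Suc n - k)) =
    (\<Oplus>k\<in>{..n}. [Suc k] \<cdot> a (Suc k) \<otimes> b (n - k)) \<oplus>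
    (\<Oplus>k\<in>{..n}. a k \<otimes> [Suc (n - k)] \<cdot> b (Suc (n - k)))"
proof -
  let ?t = "\<lambda>k. a k \<otimes> b (Suc n - k)"
  have sum: "[(m::nat)] \<cdot> (\<Oplus>k\<in>A. ?t k) = (\<Oplus>k\<in>A. [m] \<cdot> ?t k)" if "finite A" for m A
    using that a b by (induction A rule: finite_induct) (auto simp: add.nat_pow_distrib)
  have "[Suc n] \<cdot> (\<Oplus>k\<in>{..Suc n}. ?t k) = (\<Oplus>k\<in>{..Suc n}. [k] \<cdot> ?t k \<oplus> [(Suc n - k)] \<cdot> ?t k)"
    unfolding sum[OF finite_atMost]
  proof (intro add.finprod_cong')
    fix k assume "k \<in> {..Suc n}"
    then show "[Suc n] \<cdot> ?t k = [k] \<cdot> ?t k \<oplus> [(Suc n - k)] \<cdot> ?t k"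
      using add.nat_pow_mult[of "?t k" k "Suc n - k"] a b by simp
  qed (use a b in auto)
  also have "\<dots> = (\<Oplus>k\<in>{..Suc n}. [k] \<cdot> ?t k) \<oplus> (\<Oplus>k\<in>{..Suc n}. [(Suc n - k)] \<cdot> ?t k)"
    using a b by (intro finsum_addf) auto
  also have "(\<Oplus>k\<in>{..Suc n}. [k] \<cdot> ?t k) = (\<Oplus>k\<in>{..n}. [Suc k] \<cdot> ?t (Suc k))"
    using a b by (subst finsum_Suc2) (auto simp del: add.nat_pow_Suc)
  also have "\<dots> = (\<Oplus>k\<in>{..n}. [Suc k] \<cdot> a (Suc k) \<otimes> b (n - k))"
    using a b by (intro add.finprod_cong') (auto simp del: add.nat_pow_Suc simp: add_pow_ldistr)
  also have "(\<Oplus>k\<in>{..Suc n}. [(Suc n - k)] \<cdot> ?t k) = (\<Oplus>k\<in>{..n}. [(Suc n - k)] \<cdot> ?t k)"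
    using a b by (subst finsum_Suc) (auto simp del: add.nat_pow_Suc)
  also have "\<dots> = (\<Oplus>k\<in>{..n}. a k \<otimes> [Suc (n - k)] \<cdot> b (Suc (n - k)))"
    using a b by (intro add.finprod_cong')
      (auto simp del: add.nat_pow_Suc simp: add_pow_rdistr Suc_diff_le)
  finally show ?thesis .
qed

lemma (in ring) coeff_in_subring:
  assumes "subring K R" "set p \<subseteq> K"
  shows "coeff p i \<in> K"
  using ring.coeff_in_carrier[OF subring_is_ring[OF assms(1)], of p i] assms(2)
  by (simp add: coeff_consistent[OF assms(1)])

lemma (in ring) poly_eqI:
  assumes "polynomial K p" "polynomial K q" "\<And>i. coeff p i = coeff q i"
  shows "p = q"
  using coeff_iff_polynomial_cond[OF assms(1,2)] assms(3) by blast

context ring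
begin

lemma coeff_poly_deriv:
  assumes "set p \<subseteq> carrier R"
  shows "coeff (poly_deriv p) i = [Suc i] \<cdot> coeff p (Suc i)"
proof -
  let ?q = "map (\<lambda>i. [i] \<cdot> coeff p i) (rev [1..<length p])"
  have "coeff ?q i = [Suc i] \<cdot> coeff p (Suc i)"
  proof (cases "i < length p - 1")
    case True
    then have "rev [1..<length p] ! (length p - 1 - 1 - i) = Suc i"
      by (subst rev_nth) auto
    then show ?thesis
      using True by (subst coeff_nth) auto
  next
    case False
    then have "coeff ?q i = \<zero>" "coeff p (Suc i) = \<zero>"
      by (auto intro!: coeff_length)
    then show ?thesis by simp
  qed
  then show ?thesis
    unfolding poly_deriv_def by (simp add: normalize_coeff[symmetric])
qed

lemma length_poly_deriv: "length (poly_deriv p) \<le> length p - 1"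
  unfolding poly_deriv_def
  using normalize_length_le[of "map (\<lambda>i. [i] \<cdot> coeff p i) (rev [1..<length p])"] by simp

lemma poly_deriv_polynomial:
  assumes "subring K R" "set p \<subseteq> K"
  shows "polynomial K (poly_deriv p)"
  unfolding poly_deriv_def
  using coeff_in_subring[OF assms] subring_add_pow_closed[OF assms(1)]
  by (intro normalize_gives_polynomial) auto

lemma poly_deriv_in_carrier:
  "set p \<subseteq> carrier R \<Longrightarrow> set (poly_deriv p) \<subseteq> carrier R"
  by (rule polynomial_incl[OF poly_deriv_polynomial[OF carrier_is_subring]])

lemma poly_deriv_closed:
  assumes "subring K R" "p \<in> carrier (K[X])"
  shows "poly_deriv p \<in> carrier (K[X])"
  using poly_deriv_polynomial[OF assms(1)] polynomial_incl assms(2)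
  by (simp flip: univ_poly_carrier)

lemma poly_deriv_zero [simp]: "poly_deriv [] = []"
  and poly_deriv_const [simp]: "poly_deriv [k] = []"
  unfolding poly_deriv_def by simp_all

lemma poly_deriv_normalize:
  assumes "set p \<subseteq> carrier R"
  shows "poly_deriv (normalize p) = poly_deriv p"
  using assms
  by (intro poly_eqI[OF poly_deriv_polynomial poly_deriv_polynomial, OF carrier_is_subring _ carrier_is_subring])
    (auto simp: coeff_poly_deriv normalize_in_carrier normalize_coeff[symmetric]
      simp del: add.nat_pow_Suc)

lemma poly_deriv_add:
  assumes "set p \<subseteq> carrier R" "set q \<subseteq> carrier R"
  shows "poly_deriv (poly_add p q) = poly_add (poly_deriv p) (poly_deriv q)"
proof (rule poly_eqI)
  show "polynomial (carrier R) (poly_deriv (poly_add p q))"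
    using assms by (intro poly_deriv_polynomial carrier_is_subring poly_add_in_carrier)
  show "polynomial (carrier R) (poly_add (poly_deriv p) (poly_deriv q))"
    using assms by (intro poly_add_is_polynomial carrier_is_subring poly_deriv_in_carrier)
  show "coeff (poly_deriv (poly_add p q)) i = coeff (poly_add (poly_deriv p) (poly_deriv q)) i" for i
    using assms by (simp del: poly_add.simps add.nat_pow_Suc
        add: coeff_poly_deriv poly_add_in_carrier poly_add_coeff poly_deriv_in_carrier
          add.nat_pow_distrib)
qed

lemma eval_poly_deriv:
  assumes "set p \<subseteq> carrier R" "x \<in> carrier R"
  shows "eval (poly_deriv p) x = eval (map (\<lambda>i. [i] \<cdot> coeff p i) (rev [1..<length p])) x"
  unfolding poly_deriv_def using assms by (intro eval_normalize) auto

end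

lemma (in cring) poly_deriv_mult:
  assumes "set p \<subseteq> carrier R" "set q \<subseteq> carrier R"
  shows "poly_deriv (poly_mult p q) =
    poly_add (poly_mult (poly_deriv p) q) (poly_mult p (poly_deriv q))"
proof (rule poly_eqI)
  show "polynomial (carrier R) (poly_deriv (poly_mult p q))"
    using assms by (intro poly_deriv_polynomial carrier_is_subring poly_mult_in_carrier)
  show "polynomial (carrier R) (poly_add (poly_mult (poly_deriv p) q) (poly_mult p (poly_deriv q)))"
    using assms
    by (intro poly_add_is_polynomial carrier_is_subring poly_mult_in_carrier poly_deriv_in_carrier)
  show "coeff (poly_deriv (poly_mult p q)) i =
    coeff (poly_add (poly_mult (poly_deriv p) q) (poly_mult p (poly_deriv q))) i" for i
    using assms add_pow_cauchy_product[of "coeff p" "coeff q" i]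
    by (simp del: poly_mult.simps poly_add.simps finsum_Suc add.nat_pow_Suc add: coeff_poly_deriv
        poly_add_coeff poly_mult_coeff poly_mult_in_carrier poly_deriv_in_carrier)
qed

lemma (in ring_hom_ring) eval_poly_deriv_hom:
  assumes x: "x \<in> carrier R" and p: "set p \<subseteq> carrier R"
  shows "h (R.eval (R.poly_deriv p) x) = eval (poly_deriv (map h p)) (h x)"
proof -
  have hp: "set (map h p) \<subseteq> carrier S"
    using p by auto
  have "h (R.eval (R.poly_deriv p) x) =
      eval (map (h \<circ> (\<lambda>i. [i] \<cdot>\<^bsub>R\<^esub> R.coeff p i)) (rev [1..<length p])) (h x)"
    using p x by (subst R.eval_poly_deriv[OF p x], subst eval_hom') auto
  also have "\<dots> = eval (poly_deriv (map h p)) (h x)"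
    using p hp x by (simp add: eval_poly_deriv comp_def hom_add_pow_nat coeff_hom')
  finally show ?thesis .
qed

lemma (in cring) eval_smult:
  assumes "c \<in> carrier R" "set p \<subseteq> carrier R" "x \<in> carrier R"
  shows "eval (map ((\<otimes>) c) p) x = c \<otimes> eval p x"
  using assms(2)
proof (induction p)
  case Nil
  then show ?case using assms by simp
next
  case (Cons a p)
  then show ?case
    using assms eval_in_carrier[of p x] by (simp add: r_distr m_assoc)
qed

lemma (in cring) eval_poly_deriv_smult:
  assumes c: "c \<in> carrier R" and p: "set p \<subseteq> carrier R" and x: "x \<in> carrier R"
  shows "eval (poly_deriv (map ((\<otimes>) c) p)) x = c \<otimes> eval (poly_deriv p) x"
proof -
  have "set (map ((\<otimes>) c) p) \<subseteq> carrier R"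
    using c p by auto
  then have "eval (poly_deriv (map ((\<otimes>) c) p)) x =
      eval (map ((\<otimes>) c) (map (\<lambda>i. [i] \<cdot> coeff p i) (rev [1..<length p]))) x"
    using c p x by (simp add: eval_poly_deriv scalar_coeff add_pow_rdistr comp_def)
  also have "\<dots> = c \<otimes> eval (poly_deriv p) x"
    using c p x by (subst eval_smult) (auto simp: eval_poly_deriv)
  finally show ?thesis .
qed

context domain
begin

context
  fixes K assumes K: "subring K R"
begin

interpretation UP: domain "K[X]"
  using univ_poly_is_domain[OF K] .

lemma univ_poly_in_carrier: "p \<in> carrier (K[X]) \<Longrightarrow> set p \<subseteq> carrier R"
  using polynomial_in_carrier[OF K] by (simp add: univ_poly_carrier)

lemma poly_deriv_univ_poly_add:
  "\<lbrakk>p \<in> carrier (K[X]); q \<in> carrier (K[X])\<rbrakk> \<Longrightarrow>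
    poly_deriv (p \<oplus>\<^bsub>K[X]\<^esub> q) = poly_deriv p \<oplus>\<^bsub>K[X]\<^esub> poly_deriv q"
  unfolding univ_poly_add by (simp del: poly_add.simps add: poly_deriv_add univ_poly_in_carrier)

lemma poly_deriv_univ_poly_mult:
  "\<lbrakk>p \<in> carrier (K[X]); q \<in> carrier (K[X])\<rbrakk> \<Longrightarrow>
    poly_deriv (p \<otimes>\<^bsub>K[X]\<^esub> q) =
      poly_deriv p \<otimes>\<^bsub>K[X]\<^esub> q \<oplus>\<^bsub>K[X]\<^esub> p \<otimes>\<^bsub>K[X]\<^esub> poly_deriv q"
  unfolding univ_poly_add univ_poly_mult
  by (simp del: poly_add.simps add: poly_deriv_mult univ_poly_in_carrier)

lemma poly_deriv_univ_poly_a_inv: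
  assumes "p \<in> carrier (K[X])"
  shows "poly_deriv (\<ominus>\<^bsub>K[X]\<^esub> p) = \<ominus>\<^bsub>K[X]\<^esub> poly_deriv p"
proof -
  have "poly_deriv (\<ominus>\<^bsub>K[X]\<^esub> p) \<oplus>\<^bsub>K[X]\<^esub> poly_deriv p = poly_deriv \<zero>\<^bsub>K[X]\<^esub>"
    using poly_deriv_univ_poly_add[of "\<ominus>\<^bsub>K[X]\<^esub> p" p] assms by (simp add: UP.l_neg)
  then show ?thesis
    using UP.minus_equality poly_deriv_closed[OF K] assms
    by (simp add: univ_poly_zero)
qed

lemma poly_deriv_univ_poly_pow:
  assumes "p \<in> carrier (K[X])"
  shows "poly_deriv (p [^]\<^bsub>K[X]\<^esub> Suc n) = [Suc n] \<cdot>\<^bsub>K[X]\<^esub> (p [^]\<^bsub>K[X]\<^esub> n \<otimes>\<^bsub>K[X]\<^esub> poly_deriv p)"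
proof (induction n)
  case 0
  then show ?case using assms poly_deriv_closed[OF K] by simp
next
  case (Suc n)
  let ?D = "poly_deriv p" and ?q = "p [^]\<^bsub>K[X]\<^esub> n"
  have closed: "?D \<in> carrier (K[X])" "?q \<in> carrier (K[X])"
    using assms poly_deriv_closed[OF K] by auto
  have "poly_deriv (p [^]\<^bsub>K[X]\<^esub> Suc (Suc n)) =
    [Suc n] \<cdot>\<^bsub>K[X]\<^esub> (?q \<otimes>\<^bsub>K[X]\<^esub> ?D) \<otimes>\<^bsub>K[X]\<^esub> p \<oplus>\<^bsub>K[X]\<^esub> p [^]\<^bsub>K[X]\<^esub> Suc n \<otimes>\<^bsub>K[X]\<^esub> ?D"
    using poly_deriv_univ_poly_mult[of "p [^]\<^bsub>K[X]\<^esub> Suc n" p] assms Suc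
    by (metis UP.nat_pow_Suc UP.nat_pow_closed)
  also have "[Suc n] \<cdot>\<^bsub>K[X]\<^esub> (?q \<otimes>\<^bsub>K[X]\<^esub> ?D) \<otimes>\<^bsub>K[X]\<^esub> p =
      [Suc n] \<cdot>\<^bsub>K[X]\<^esub> (p [^]\<^bsub>K[X]\<^esub> Suc n \<otimes>\<^bsub>K[X]\<^esub> ?D)"
    using assms closed
    by (simp del: UP.add.nat_pow_Suc add: UP.add_pow_ldistr UP.add_pow_rdistr UP.m_ac)
  finally show ?case
    using assms closed by simp
qed

lemma poly_deriv_univ_poly_pow_mult:
  assumes p: "p \<in> carrier (K[X])" and q: "q \<in> carrier (K[X])"
  shows "poly_deriv (p [^]\<^bsub>K[X]\<^esub> Suc n \<otimes>\<^bsub>K[X]\<^esub> q) = p [^]\<^bsub>K[X]\<^esub> n \<otimes>\<^bsub>K[X]\<^esub>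
    ([Suc n] \<cdot>\<^bsub>K[X]\<^esub> (poly_deriv p \<otimes>\<^bsub>K[X]\<^esub> q) \<oplus>\<^bsub>K[X]\<^esub> p \<otimes>\<^bsub>K[X]\<^esub> poly_deriv q)"
proof -
  have "poly_deriv (p [^]\<^bsub>K[X]\<^esub> Suc n \<otimes>\<^bsub>K[X]\<^esub> q) =
      poly_deriv (p [^]\<^bsub>K[X]\<^esub> Suc n) \<otimes>\<^bsub>K[X]\<^esub> q
        \<oplus>\<^bsub>K[X]\<^esub> p [^]\<^bsub>K[X]\<^esub> Suc n \<otimes>\<^bsub>K[X]\<^esub> poly_deriv q"
    using p q by (intro poly_deriv_univ_poly_mult UP.nat_pow_closed)
  also have "\<dots> = [Suc n] \<cdot>\<^bsub>K[X]\<^esub> (p [^]\<^bsub>K[X]\<^esub> n \<otimes>\<^bsub>K[X]\<^esub> poly_deriv p) \<otimes>\<^bsub>K[X]\<^esub> q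
        \<oplus>\<^bsub>K[X]\<^esub> p [^]\<^bsub>K[X]\<^esub> Suc n \<otimes>\<^bsub>K[X]\<^esub> poly_deriv q"
    unfolding poly_deriv_univ_poly_pow[OF p] ..
  also have "\<dots> = p [^]\<^bsub>K[X]\<^esub> n \<otimes>\<^bsub>K[X]\<^esub>
      ([Suc n] \<cdot>\<^bsub>K[X]\<^esub> (poly_deriv p \<otimes>\<^bsub>K[X]\<^esub> q) \<oplus>\<^bsub>K[X]\<^esub> p \<otimes>\<^bsub>K[X]\<^esub> poly_deriv q)"
    using p q poly_deriv_closed[OF K p] poly_deriv_closed[OF K q]
    by (simp del: UP.add.nat_pow_Suc
        add: UP.add_pow_ldistr UP.add_pow_rdistr UP.m_ac UP.r_distr)
  finally show ?thesis .
qed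

lemma poly_deriv_var: "poly_deriv X = \<one>\<^bsub>K[X]\<^esub>"
  unfolding poly_deriv_def var_def univ_poly_one by simp

lemma poly_deriv_poly_of_const: "poly_deriv (poly_of_const k) = []"
  unfolding poly_of_const_def by simp

lemma subring_poly_deriv_zero:
  "subring {p \<in> carrier (K[X]). poly_deriv p = []} (K[X])"
proof (rule UP.subringI)
  show "\<one>\<^bsub>K[X]\<^esub> \<in> {p \<in> carrier (K[X]). poly_deriv p = []}"
    using UP.one_closed by (simp add: univ_poly_one)
qed (auto simp: poly_deriv_univ_poly_add poly_deriv_univ_poly_mult poly_deriv_univ_poly_a_inv
    simp flip: univ_poly_zero[of R K])

end

end

section \<open>The characteristic\<close>

definition (in ring) characteristic :: nat
  where "characteristic = group.ord (add_monoid R) \<one>"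

lemma (in ring) add_pow_one_eq_zero_iff: "[(n::nat)] \<cdot> \<one> = \<zero> \<longleftrightarrow> characteristic dvd n"
  unfolding characteristic_def using add.pow_eq_id[of \<one> n] by simp

lemma (in domain) add_pow_eq_zero_iff:
  "x \<in> carrier R \<Longrightarrow> [(n::nat)] \<cdot> x = \<zero> \<longleftrightarrow> characteristic dvd n \<or> x = \<zero>"
  by (simp add: add_pow_eq_mult[of x] integral_iff add_pow_one_eq_zero_iff)

lemma (in ring) char_exponent_eq:
  "char_exponent R = (if characteristic = 0 then 1 else characteristic)"
  unfolding char_exponent_def characteristic_def by (simp add: Let_def)

lemma (in domain) characteristic_eq_0_or_prime:
  "characteristic = 0 \<or> Factorial_Ring.prime characteristic"
proof -
  have "Factorial_Ring.prime characteristic" if "characteristic \<noteq> 0"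
  proof (rule prime_natI)
    have "characteristic \<noteq> 1"
      using add_pow_one_eq_zero_iff[of 1] by auto
    then show "characteristic \<ge> 2"
      using that by linarith
  next
    fix m n assume mn: "characteristic dvd m * n"
    have "[m] \<cdot> \<one> \<otimes> [n] \<cdot> \<one> = [(m * n)] \<cdot> \<one>"
      by (simp add: add.nat_pow_pow mult.commute flip: add_pow_eq_mult)
    also have "\<dots> = \<zero>"
      using mn add_pow_one_eq_zero_iff by blast
    finally show "characteristic dvd m \<or> characteristic dvd n"
      using integral by (simp flip: add_pow_one_eq_zero_iff)
  qed
  then show ?thesis by blast
qed

lemma (in ring) characteristic_subring:
  assumes "subring K R"
  shows "ring.characteristic (R\<lparr>carrier := K\<rparr>) = characteristic"
proof -
  interpret K: ring "R\<lparr>carrier := K\<rparr>"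
    by (rule subring_is_ring[OF assms])
  have "[(n::nat)] \<cdot>\<^bsub>R\<lparr>carrier := K\<rparr>\<^esub> \<one> = [n] \<cdot> \<one>" for n
    by (induction n) auto
  then have "K.characteristic dvd n \<longleftrightarrow> characteristic dvd n" for n
    using K.add_pow_one_eq_zero_iff[of n] add_pow_one_eq_zero_iff[of n] by simp
  then show ?thesis
    using dvd_antisym dvd_refl by blast
qed

lemma (in ring_hom_ring) characteristic_dvd: "S.characteristic dvd R.characteristic"
  using hom_add_pow_nat[of "\<one>\<^bsub>R\<^esub>" R.characteristic] R.add_pow_one_eq_zero_iff[of R.characteristic]
  by (simp flip: S.add_pow_one_eq_zero_iff)

lemma (in domain) poly_deriv_pow_characteristic:
  assumes K: "subring K R" and g: "g \<in> carrier (K[X])"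
  shows "poly_deriv (g [^]\<^bsub>K[X]\<^esub> characteristic) = []"
proof (cases characteristic)
  case 0
  then show ?thesis by (simp add: univ_poly_one)
next
  case (Suc n)
  interpret UP: domain "K[X]"
    using univ_poly_is_domain[OF K] .
  have "UP.characteristic dvd characteristic"
    using ring_hom_ring.characteristic_dvd[OF canonical_embedding_ring_hom[OF K]]
    by (simp add: characteristic_subring[OF K])
  then show ?thesis
    using poly_deriv_univ_poly_pow[OF K g, of n] Suc g poly_deriv_closed[OF K g]
      UP.add_pow_eq_zero_iff[of "g [^]\<^bsub>K[X]\<^esub> n \<otimes>\<^bsub>K[X]\<^esub> poly_deriv g" "Suc n"]
    by (simp add: univ_poly_zero del: UP.nat_pow_Suc UP.add.nat_pow_Suc)
qed

section \<open>Separable elements\<close>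

definition (in ring) separable_over :: "'a set \<Rightarrow> 'a \<Rightarrow> bool"
  where "separable_over K x \<longleftrightarrow>
    (\<exists>f. set f \<subseteq> K \<and> eval f x = \<zero> \<and> eval (poly_deriv f) x \<noteq> \<zero>)"

lemma (in ring) separable_over_mono:
  "separable_over K x \<Longrightarrow> K \<subseteq> K' \<Longrightarrow> separable_over K' x"
  unfolding separable_over_def by blast

lemma (in ring) separable_overI:
  assumes "f \<in> carrier (K[X])" "eval f x = \<zero>" "eval (poly_deriv f) x \<noteq> \<zero>"
  shows "separable_over K x"
  using assms polynomial_incl unfolding separable_over_def by (metis univ_poly_carrier)

lemma (in ring) separable_overE:
  assumes "separable_over K x" "K \<subseteq> carrier R" "x \<in> carrier R"
  obtains f where "f \<in> carrier (K[X])" "eval f x = \<zero>" "eval (poly_deriv f) x \<noteq> \<zero>"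
proof -
  obtain f where f: "set f \<subseteq> K" "eval f x = \<zero>" "eval (poly_deriv f) x \<noteq> \<zero>"
    using assms(1) unfolding separable_over_def by blast
  have "set f \<subseteq> carrier R"
    using f(1) assms(2) by blast
  then show thesis
    using that[of "normalize f"] f assms(3) normalize_gives_polynomial[OF f(1)]
    by (simp add: poly_deriv_normalize eval_normalize flip: univ_poly_carrier)
qed

lemma (in ring) separable_over_self:
  assumes K: "subring K R" and x: "x \<in> K" and "\<one> \<noteq> \<zero>"
  shows "separable_over K x"
proof -
  have "x \<in> carrier R" "\<one> \<in> K" "\<ominus> x \<in> K"
    using subringE[OF K] x by auto
  then show ?thesis
    using \<open>\<one> \<noteq> \<zero>\<close> unfolding separable_over_def
    by (intro exI[of _ "[\<one>, \<ominus> x]"]) (auto simp: poly_deriv_def r_neg)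
qed

lemma (in domain) simple_extension_characteristic_pow_subset:
  assumes K: "subring K R" and z: "z \<in> carrier R"
  shows "simple_extension K (z [^] characteristic) \<subseteq>
    (\<lambda>f. eval f z) ` {f \<in> carrier (K[X]). poly_deriv f = []}" (is "_ \<subseteq> ?C")
proof -
  interpret UP: domain "K[X]"
    using univ_poly_is_domain[OF K] .
  interpret ev: ring_hom_ring "K[X]" R "\<lambda>p. eval p z"
    using eval_ring_hom[OF K z] .
  interpret const: ring_hom_ring "R\<lparr>carrier := K\<rparr>" "K[X]" poly_of_const
    using canonical_embedding_ring_hom[OF K] .
  show ?thesis
  proof (rule simple_extension_subring_incl[OF ev.img_is_subring[OF subring_poly_deriv_zero[OF K]]])
    show "K \<subseteq> ?C"
    proof
      fix k assume k: "k \<in> K"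
      then have "eval (poly_of_const k) z = k"
        using subringE(1)[OF K] z unfolding poly_of_const_def by auto
      then show "k \<in> ?C"
        using const.hom_closed[of k] k
        by (intro image_eqI[of _ _ "poly_of_const k"]) (auto simp: poly_deriv_poly_of_const[OF K])
    qed
    have X: "X \<in> carrier (K[X])"
      using var_closed[OF K] by simp
    then have "eval (X [^]\<^bsub>K[X]\<^esub> characteristic) z = z [^] characteristic"
      using z by (simp add: ev.hom_nat_pow eval_var)
    then show "z [^] characteristic \<in> ?C"
      using poly_deriv_pow_characteristic[OF K X] UP.nat_pow_closed[OF X]
      by (intro image_eqI[of _ _ "X [^]\<^bsub>K[X]\<^esub> characteristic"]) auto
  qed
qed

lemma (in domain) separable_over_if_mem_simple_extension_pow:
  assumes K: "subring K R" and z: "z \<in> carrier R"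
    and mem: "z \<in> simple_extension K (z [^] characteristic)"
  shows "separable_over K z"
proof -
  interpret UP: domain "K[X]"
    using univ_poly_is_domain[OF K] .
  interpret ev: ring_hom_ring "K[X]" R "\<lambda>p. eval p z"
    using eval_ring_hom[OF K z] .
  have X: "X \<in> carrier (K[X])"
    using var_closed[OF K] by simp
  obtain f where f: "f \<in> carrier (K[X])" "poly_deriv f = []" "eval f z = z"
    using simple_extension_characteristic_pow_subset[OF K z] mem by auto
  show ?thesis
  proof (rule separable_overI)
    show "X \<ominus>\<^bsub>K[X]\<^esub> f \<in> carrier (K[X])" "eval (X \<ominus>\<^bsub>K[X]\<^esub> f) z = \<zero>"
      using f X z by (simp_all add: UP.minus_eq eval_var r_neg)
    have "poly_deriv (X \<ominus>\<^bsub>K[X]\<^esub> f) = \<one>\<^bsub>K[X]\<^esub> \<ominus>\<^bsub>K[X]\<^esub> \<zero>\<^bsub>K[X]\<^esub>"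
      using f X by (simp add: UP.minus_eq poly_deriv_univ_poly_add[OF K]
          poly_deriv_univ_poly_a_inv[OF K] poly_deriv_var[OF K] univ_poly_zero)
    then show "eval (poly_deriv (X \<ominus>\<^bsub>K[X]\<^esub> f)) z \<noteq> \<zero>"
      using ev.hom_one by (simp add: UP.minus_eq)
  qed
qed

context field
begin

context
  fixes K assumes K: "subfield K R"
begin

interpretation UP: principal_domain "K[X]"
  using univ_poly_is_principal[OF K] .

lemma Irr_divides_iff:
  assumes x: "x \<in> carrier R" "(algebraic over K) x" and f: "f \<in> carrier (K[X])"
  shows "Irr K x divides\<^bsub>K[X]\<^esub> f \<longleftrightarrow> eval f x = \<zero>"
proof
  assume "Irr K x divides\<^bsub>K[X]\<^esub> f"
  then obtain h where h: "h \<in> carrier (K[X])" "f = Irr K x \<otimes>\<^bsub>K[X]\<^esub> h"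
    unfolding factor_def by blast
  interpret ev: ring_hom_ring "K[X]" R "\<lambda>p. eval p x"
    using eval_ring_hom[OF subfieldE(1)[OF K] x(1)] .
  show "eval f x = \<zero>"
    using h IrrE[OF K x] by simp
next
  assume "eval f x = \<zero>"
  then show "Irr K x divides\<^bsub>K[X]\<^esub> f"
    using Irr_minimal[OF K x f] pdivides_iff_shell[OF K IrrE(1)[OF K x] f] by blast
qed

lemma degree_Irr_le:
  assumes "x \<in> carrier R" "f \<in> carrier (K[X])" "f \<noteq> []" "eval f x = \<zero>"
  shows "degree (Irr K x) \<le> degree f"
proof -
  have alg: "(algebraic over K) x"
    using algebraicI[OF assms(2-4)] .
  then show ?thesis
    using pdivides_imp_degree_le[OF subfieldE(1)[OF K] IrrE(1)[OF K assms(1) alg] assms(2,3)]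
      Irr_minimal[OF K assms(1) alg assms(2,4)] by blast
qed

lemma eval_poly_deriv_Irr_neq_zero:
  assumes x: "x \<in> carrier R" "(algebraic over K) x" and "poly_deriv (Irr K x) \<noteq> []"
  shows "eval (poly_deriv (Irr K x)) x \<noteq> \<zero>"
proof
  note Irr = IrrE[OF K x]
  assume "eval (poly_deriv (Irr K x)) x = \<zero>"
  then have "degree (Irr K x) \<le> degree (poly_deriv (Irr K x))"
    using degree_Irr_le x(1) poly_deriv_closed[OF subfieldE(1)[OF K] Irr(1)] assms(3) by blast
  moreover have "degree (poly_deriv (Irr K x)) < degree (Irr K x)"
    using length_poly_deriv[of "Irr K x"] pirreducible_degree[OF K Irr(1,2)] by linarith
  ultimately show False by simp
qed

lemma separable_over_imp_algebraic:
  assumes "separable_over K x" "x \<in> carrier R"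
  shows "(algebraic over K) x"
proof -
  obtain f where f: "f \<in> carrier (K[X])" "eval f x = \<zero>" "eval (poly_deriv f) x \<noteq> \<zero>"
    using separable_overE[OF assms(1) subfieldE(3)[OF K] assms(2)] .
  then show ?thesis
    by (intro algebraicI[of f]) auto
qed

lemma separable_over_iff_eval_poly_deriv_Irr:
  assumes x: "x \<in> carrier R" "(algebraic over K) x"
  shows "separable_over K x \<longleftrightarrow> eval (poly_deriv (Irr K x)) x \<noteq> \<zero>"
proof
  note K' = subfieldE(1)[OF K] and Irr = IrrE[OF K x]
  assume "separable_over K x"
  then obtain f where f: "f \<in> carrier (K[X])" "eval f x = \<zero>" "eval (poly_deriv f) x \<noteq> \<zero>"
    using separable_overE subfieldE(3)[OF K] x(1) by blast
  then obtain h where h: "h \<in> carrier (K[X])" "f = Irr K x \<otimes>\<^bsub>K[X]\<^esub> h"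
    using Irr_divides_iff[OF x f(1)] unfolding factor_def by blast
  interpret ev: ring_hom_ring "K[X]" R "\<lambda>p. eval p x"
    using eval_ring_hom[OF K' x(1)] .
  have "eval (poly_deriv f) x = eval (poly_deriv (Irr K x)) x \<otimes> eval h x"
    using h Irr poly_deriv_closed[OF K'] by (simp add: poly_deriv_univ_poly_mult[OF K'])
  then show "eval (poly_deriv (Irr K x)) x \<noteq> \<zero>"
    using f(3) ev.hom_closed[OF h(1)] by auto
next
  assume "eval (poly_deriv (Irr K x)) x \<noteq> \<zero>"
  then show "separable_over K x"
    using separable_overI[OF IrrE(1,4)[OF K x]] by blast
qed

lemma separable_over_if_degree_Irr_less_characteristic:
  assumes x: "x \<in> carrier R" "(algebraic over K) x"
    and deg: "characteristic = 0 \<or> degree (Irr K x) < characteristic"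
  shows "separable_over K x"
proof -
  note Irr = IrrE[OF K x]
  obtain d where d: "degree (Irr K x) = Suc d"
    using pirreducible_degree[OF K Irr(1,2)] by (cases "degree (Irr K x)") auto
  then have "Irr K x \<noteq> []"
    by auto
  then have "coeff (poly_deriv (Irr K x)) d = [degree (Irr K x)] \<cdot> \<one>"
    using coeff_poly_deriv[OF univ_poly_in_carrier[OF subfieldE(1)[OF K] Irr(1)], of d]
      lead_coeff_simp[of "Irr K x"] Irr(3) d by simp
  also have "\<dots> \<noteq> \<zero>"
    using deg d unfolding add_pow_one_eq_zero_iff by (auto dest: dvd_imp_le)
  finally have "poly_deriv (Irr K x) \<noteq> []"
    by auto
  then show ?thesis
    using eval_poly_deriv_Irr_neq_zero[OF x] separable_over_iff_eval_poly_deriv_Irr[OF x] by blast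
qed

lemma eval_cofactor_Irr_pow_eq_zero:
  assumes x: "x \<in> carrier R" "separable_over K x" and q: "q \<in> carrier (K[X])"
    and deriv: "poly_deriv (Irr K x [^]\<^bsub>K[X]\<^esub> Suc i \<otimes>\<^bsub>K[X]\<^esub> q) = []"
    and i: "\<not> characteristic dvd Suc i"
  shows "eval q x = \<zero>"
proof -
  let ?m = "Irr K x"
  note K' = subfieldE(1)[OF K]
  note alg = separable_over_imp_algebraic[OF x(2,1)]
  note Irr = IrrE[OF K x(1) alg]
  interpret ev: ring_hom_ring "K[X]" R "\<lambda>p. eval p x"
    using eval_ring_hom[OF K' x(1)] .
  note closed = poly_deriv_closed[OF K' Irr(1)] poly_deriv_closed[OF K' q] q Irr(1)
  let ?w = "[Suc i] \<cdot>\<^bsub>K[X]\<^esub> (poly_deriv ?m \<otimes>\<^bsub>K[X]\<^esub> q) \<oplus>\<^bsub>K[X]\<^esub> ?m \<otimes>\<^bsub>K[X]\<^esub> poly_deriv q"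
  have w: "?w \<in> carrier (K[X])"
    using closed by (simp del: UP.add.nat_pow_Suc)
  have "?m [^]\<^bsub>K[X]\<^esub> i \<otimes>\<^bsub>K[X]\<^esub> ?w = \<zero>\<^bsub>K[X]\<^esub>"
    using deriv unfolding poly_deriv_univ_poly_pow_mult[OF K' Irr(1) q] univ_poly_zero .
  moreover have "?m [^]\<^bsub>K[X]\<^esub> i \<noteq> \<zero>\<^bsub>K[X]\<^esub>"
    using subring_polynomial_pow_not_zero[OF K' Irr(1)] pirreducibleE(1)[OF K' Irr(1,2)]
    by (simp add: univ_poly_zero)
  ultimately have "?w = \<zero>\<^bsub>K[X]\<^esub>"
    using UP.integral_iff[OF UP.nat_pow_closed[OF Irr(1)] w] by blast
  then have "eval ?w x = \<zero>"
    using ev.hom_zero by simp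
  then have "[Suc i] \<cdot> (eval (poly_deriv ?m) x \<otimes> eval q x) = \<zero>"
    using closed Irr(4)
    by (simp add: ev.hom_add_pow_nat del: UP.add.nat_pow_Suc add.nat_pow_Suc)
  moreover have "eval (poly_deriv ?m) x \<noteq> \<zero>"
    using separable_over_iff_eval_poly_deriv_Irr[OF x(1) alg] x(2) by blast
  ultimately show ?thesis
    using closed i by (simp add: add_pow_eq_zero_iff integral_iff del: add.nat_pow_Suc)
qed

lemma Irr_pow_divides:
  assumes x: "x \<in> carrier R" "separable_over K x"
    and h: "h \<in> carrier (K[X])" "eval h x = \<zero>" "poly_deriv h = []"
    and "j \<le> characteristic"
  shows "Irr K x [^]\<^bsub>K[X]\<^esub> j divides\<^bsub>K[X]\<^esub> h"
  using assms(6)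
proof (induction j)
  case 0
  then show ?case using h by (simp add: factor_def)
next
  case (Suc j)
  let ?m = "Irr K x"
  note alg = separable_over_imp_algebraic[OF x(2,1)]
  obtain q where q: "q \<in> carrier (K[X])" "h = ?m [^]\<^bsub>K[X]\<^esub> j \<otimes>\<^bsub>K[X]\<^esub> q"
    using Suc unfolding factor_def by auto
  have "eval q x = \<zero>"
  proof (cases j)
    case 0
    then show ?thesis using q h(2) by simp
  next
    case (Suc i)
    then have "\<not> characteristic dvd Suc i"
      using Suc.prems by (auto dest: dvd_imp_le)
    then show ?thesis
      using eval_cofactor_Irr_pow_eq_zero[OF x q(1), of i] h(3) q(2) Suc by blast
  qed
  then obtain r where r: "r \<in> carrier (K[X])" "q = ?m \<otimes>\<^bsub>K[X]\<^esub> r"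
    using Irr_divides_iff[OF x(1) alg q(1)] unfolding factor_def by blast
  then have "h = ?m [^]\<^bsub>K[X]\<^esub> Suc j \<otimes>\<^bsub>K[X]\<^esub> r"
    using q IrrE(1)[OF K x(1) alg] by (simp add: UP.m_assoc)
  then show ?case
    using r(1) unfolding factor_def by blast
qed

lemma poly_deriv_zero_root_eq_zero:
  assumes x: "x \<in> carrier R" "separable_over K x"
    and h: "h \<in> carrier (K[X])" "eval h x = \<zero>" "poly_deriv h = []"
    and deg: "degree h < characteristic * degree (Irr K x)"
  shows "h = []"
proof (rule ccontr)
  assume "h \<noteq> []"
  let ?mp = "Irr K x [^]\<^bsub>K[X]\<^esub> characteristic"
  note K' = subfieldE(1)[OF K]
  note Irr = IrrE(1)[OF K x(1) separable_over_imp_algebraic[OF x(2,1)]]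
  have mp: "?mp \<in> carrier (K[X])"
    using Irr by simp
  then have "degree ?mp \<le> degree h"
    using Irr_pow_divides[OF x h order.refl] pdivides_iff_shell[OF K mp h(1)]
      pdivides_imp_degree_le[OF K' mp h(1) \<open>h \<noteq> []\<close>] by blast
  then show False
    using deg subring_polynomial_pow_degree[OF K' Irr] by simp
qed

lemma simple_extension_eq_eval_reduced:
  assumes x: "x \<in> carrier R" "(algebraic over K) x" and z: "z \<in> simple_extension K x"
  obtains g where "g \<in> carrier (K[X])" "degree g < degree (Irr K x)" "eval g x = z"
proof -
  obtain g where g: "g \<in> carrier (K[X])" "length g \<le> degree (Irr K x)" "eval g x = z"
    using z unfolding Span_exp_base[OF K x, symmetric] Span_eq_eval_img[OF K x(1)] by auto
  have "degree (Irr K x) \<ge> 1"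
    using pirreducible_degree[OF K IrrE(1,2)[OF K x]] .
  then have "degree g < degree (Irr K x)"
    using g(2) by linarith
  then show thesis
    using that g(1,3) by blast
qed

text \<open>If \<open>z = g(x)\<close> with \<open>deg g < deg (Irr K x)\<close>, then \<open>g ^ p - z ^ p\<close> has zero derivative, so it is
  divisible by \<open>Irr K x ^ p\<close>, hence zero.\<close>

lemma simple_extension_separable_pth_root:
  assumes x: "x \<in> carrier R" "separable_over K x" and z: "z \<in> simple_extension K x"
    and char: "characteristic \<noteq> 0" and zp: "z [^] characteristic \<in> K"
  shows "z \<in> K"
proof -
  let ?p = characteristic
  note K' = subfieldE(1)[OF K]
  interpret ev: ring_hom_ring "K[X]" R "\<lambda>p. eval p x"
    using eval_ring_hom[OF K' x(1)] .
  obtain g where g: "g \<in> carrier (K[X])" "degree g < degree (Irr K x)" "eval g x = z"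
    using simple_extension_eq_eval_reduced[OF x(1) separable_over_imp_algebraic[OF x(2,1)] z] .
  define c where "c = poly_of_const (z [^] ?p)"
  have c: "c \<in> carrier (K[X])" "degree c = 0" "poly_deriv c = []"
    using poly_of_const_over_subfield[OF K] zp poly_deriv_poly_of_const[OF K'] unfolding c_def
    by blast+
  have "eval c x = z [^] ?p"
    using zp subfieldE(3)[OF K] x(1) unfolding c_def poly_of_const_def by auto
  define h where "h = g [^]\<^bsub>K[X]\<^esub> ?p \<ominus>\<^bsub>K[X]\<^esub> c"
  have gp: "g [^]\<^bsub>K[X]\<^esub> ?p \<in> carrier (K[X])"
    using g by simp
  have h: "h \<in> carrier (K[X])" "eval h x = \<zero>" "poly_deriv h = []"
  proof -
    show "h \<in> carrier (K[X])" "eval h x = \<zero>"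
      using gp g c ev.hom_closed[OF g(1)] \<open>eval c x = z [^] ?p\<close>
      by (simp_all add: h_def UP.minus_eq ev.hom_nat_pow r_neg)
    show "poly_deriv h = []"
      using gp c(1) poly_deriv_pow_characteristic[OF K' g(1)] c(3) UP.minus_zero
      by (simp add: h_def UP.minus_eq poly_deriv_univ_poly_add[OF K']
          poly_deriv_univ_poly_a_inv[OF K']
          flip: univ_poly_zero[of R K])
  qed
  have "degree h \<le> max (degree (g [^]\<^bsub>K[X]\<^esub> ?p)) (degree (\<ominus>\<^bsub>K[X]\<^esub> c))"
    unfolding h_def UP.minus_eq by (subst univ_poly_add) (rule poly_add_degree)
  also have "\<dots> = ?p * degree g"
    using subring_polynomial_pow_degree[OF K' g(1)] univ_poly_a_inv_degree[OF K' c(1)] c(2) by simp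
  also have "\<dots> < ?p * degree (Irr K x)"
    using g(2) char by simp
  finally have "h = []"
    by (rule poly_deriv_zero_root_eq_zero[OF x h])
  then have "g [^]\<^bsub>K[X]\<^esub> ?p = c"
    using gp c UP.r_right_minus_eq by (simp add: h_def univ_poly_zero)
  then have "degree g = 0"
    using subring_polynomial_pow_degree[OF K' g(1), of ?p] c(2) char by simp
  then obtain k where "k \<in> K" "g = poly_of_const k"
    using poly_of_const_over_subfield[OF K] g(1) by (metis (mono_tags, lifting) imageE mem_Collect_eq)
  then show ?thesis
    using g(3) x(1) subfieldE(3)[OF K] unfolding poly_of_const_def by (auto split: if_splits)
qed

end

lemma finite_extension_separable_pth_root:
  assumes K: "subfield K R" and "set xs \<subseteq> carrier R" "\<And>x. x \<in> set xs \<Longrightarrow> separable_over K x"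
    and char: "characteristic \<noteq> 0"
    and "z \<in> finite_extension K xs" and zp: "z [^] characteristic \<in> K"
  shows "z \<in> K"
  using assms(2,3,5)
proof (induction xs)
  case Nil
  then show ?case by simp
next
  case (Cons x xs)
  let ?F = "finite_extension K xs"
  have F: "subfield ?F R"
    using finite_extension_is_subfield[OF K] Cons.prems separable_over_imp_algebraic[OF K] by auto
  have KF: "K \<subseteq> ?F"
    using finite_extension_incl[OF subfieldE(3)[OF K]] Cons.prems(1) by simp
  have "z \<in> ?F"
  proof (rule simple_extension_separable_pth_root[OF F])
    show "separable_over ?F x"
      using separable_over_mono[OF _ KF] Cons.prems(2) by simp
  qed (use Cons.prems zp KF char in auto)
  then show ?case
    using Cons by simp
qed

lemma separable_over_finite_extension:
  assumes K: "subfield K R" and xs: "set xs \<subseteq> carrier R" "\<And>x. x \<in> set xs \<Longrightarrow> separable_over K x"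
    and z: "z \<in> finite_extension K xs"
  shows "separable_over K z"
proof -
  note K' = subfieldE(1)[OF K]
  have alg: "(algebraic over K) u" if "u \<in> finite_extension K xs" for u
    using finite_extesion_mem_imp_algebraic[OF K xs(1) _ that] separable_over_imp_algebraic[OF K] xs
    by blast
  note F = finite_extension_is_subring[OF K' xs(1)]
  have zc: "z \<in> carrier R"
    using z subringE(1)[OF F] by blast
  show ?thesis
  proof (cases "characteristic = 0")
    case True
    then show ?thesis
      using separable_over_if_degree_Irr_less_characteristic[OF K zc alg[OF z]] by blast
  next
    case False
    let ?zp = "z [^] characteristic" and ?E = "simple_extension K (z [^] characteristic)"
    have zp: "?zp \<in> carrier R" "(algebraic over K) ?zp"
      using zc alg[OF subring_nat_pow_closed[OF F z]] by simp_all
    have KE: "K \<subseteq> ?E"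
      using simple_extension_incl[OF subfieldE(3)[OF K] zp(1)] .
    have "z \<in> ?E"
    proof (rule finite_extension_separable_pth_root[OF _ xs(1) _ False])
      show "subfield ?E R"
        using simple_extension_is_subfield[OF K zp(1)] zp(2) by blast
      show "separable_over ?E x" if "x \<in> set xs" for x
        using separable_over_mono[OF xs(2)[OF that] KE] .
      show "z \<in> finite_extension ?E xs"
        using mono_finite_extension[OF KE] z by blast
      show "?zp \<in> ?E"
        using simple_extension_mem[OF K' zp(1)] .
    qed
    then show ?thesis
      by (rule separable_over_if_mem_simple_extension_pow[OF K' zc])
  qed
qed

lemma subfield_of_separables:
  assumes K: "subfield K R"
  shows "subfield {x \<in> carrier R. separable_over K x} R" (is "subfield ?S R")
proof (rule subfieldI'[OF subringI])
  note K' = subfieldE(1)[OF K]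
  show "?S \<subseteq> carrier R" "\<one> \<in> ?S"
    using separable_over_self[OF K' subringE(3)[OF K']] by auto
  have mem: "z \<in> ?S" if "set xs \<subseteq> ?S" "z \<in> finite_extension K xs" for xs z
    using that separable_over_finite_extension[OF K, of xs z]
      finite_extension_in_carrier[OF subfieldE(3)[OF K], of xs] by blast
  {
    fix x y assume xy: "x \<in> ?S" "y \<in> ?S"
    then have "set [x, y] \<subseteq> carrier R" "set [x, y] \<subseteq> ?S"
      by simp_all
    note F = subringE(5-7)[OF finite_extension_is_subring[OF K' this(1)]]
      finite_extension_mem[OF K' this(1)] and mem = mem[OF this(2)]
    show "\<ominus> x \<in> ?S"
      by (rule mem[OF F(1)]) (use F(4) in simp)
    show "x \<otimes> y \<in> ?S"
      by (rule mem[OF F(2)]) (use F(4) in simp_all)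
    show "x \<oplus> y \<in> ?S"
      by (rule mem[OF F(3)]) (use F(4) in simp_all)
  next
    fix x assume x: "x \<in> ?S - {\<zero>}"
    then have "x \<in> carrier R" "(algebraic over K) x" "set [x] \<subseteq> ?S"
      using separable_over_imp_algebraic[OF K] by auto
    then have "inv x \<in> finite_extension K [x]"
      using subfield_m_inv(1)[of "simple_extension K x" x] simple_extension_is_subfield[OF K, of x]
        simple_extension_mem[OF K'] x by simp
    then show "inv x \<in> ?S"
      by (rule mem[OF \<open>set [x] \<subseteq> ?S\<close>])
  }
qed

lemma degree_Irr_less:
  assumes K: "subfield K R" and x: "x \<in> carrier R" "(algebraic over K) x"
    and y: "y \<in> simple_extension K x" and "x \<notin> simple_extension K y"
  shows "degree (Irr K y) < degree (Irr K x)"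
proof -
  note Kx = simple_extension_is_subring[OF subfieldE(1)[OF K] x(1)]
  have yc: "y \<in> carrier R" "(algebraic over K) y"
    using y subringE(1)[OF Kx] simple_extesion_mem_imp_algebraic[OF K x y] by auto
  let ?b = "exp_base y (degree (Irr K y))"
  note indep = exp_base_independent[OF K yc] and dim = dimension_simple_extension[OF K x]
  have "set ?b \<subseteq> simple_extension K x"
    using subring_nat_pow_closed[OF Kx y] by (auto simp: exp_base_def)
  moreover have "Span K ?b \<noteq> simple_extension K x"
    using Span_exp_base[OF K yc] simple_extension_mem[OF subfieldE(1)[OF K] x(1)] assms(5) by blast
  ultimately show ?thesis
    using independent_length_le_dimension[OF K dim indep]
      independent_length_eq_dimension[OF K dim indep]
    by (simp add: exp_base_def)
qed

lemma separable_over_nat_pow: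
  assumes K: "subfield K R" and x: "x \<in> carrier R" "separable_over K x"
  shows "separable_over K (x [^] (n::nat))"
  using subring_nat_pow_closed[OF subfieldE(1)[OF subfield_of_separables[OF K]], of x n] x by simp

text \<open>The degrees in the chain \<open>K(x) \<supseteq> K(x ^ p) \<supseteq> K(x ^ (p ^ 2)) \<supseteq> \<dots>\<close> decrease strictly until some
  \<open>y = x ^ (p ^ i)\<close> lies in \<open>K(y ^ p)\<close>, that is, is separable.\<close>

lemma separable_over_characteristic_pow:
  assumes K: "subfield K R" and char: "characteristic \<noteq> 0"
    and "x \<in> carrier R" "(algebraic over K) x" "degree (Irr K x) \<le> n"
  shows "separable_over K (x [^] (characteristic ^ n))"
  using assms(3-)
proof (induction n arbitrary: x)
  case 0
  then show ?case
    using pirreducible_degree[OF K IrrE(1,2)[OF K]] by fastforce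
next
  case (Suc n)
  note K' = subfieldE(1)[OF K] and x = Suc.prems(1,2)
  let ?y = "x [^] characteristic"
  show ?case
  proof (cases "x \<in> simple_extension K ?y")
    case True
    then show ?thesis
      using separable_over_nat_pow[OF K x(1)] separable_over_if_mem_simple_extension_pow[OF K' x(1)]
      by blast
  next
    case False
    have y: "?y \<in> simple_extension K x"
      using subring_nat_pow_closed[OF simple_extension_is_subring[OF K' x(1)]]
        simple_extension_mem[OF K' x(1)] by blast
    then have "separable_over K (?y [^] (characteristic ^ n))"
      using Suc degree_Irr_less[OF K x y False] simple_extesion_mem_imp_algebraic[OF K x y] by simp
    then show ?thesis
      using x by (simp add: nat_pow_pow)
  qed
qed

text \<open>The product is zero in the characteristics between \<open>1\<close> and \<open>d\<close> different from \<open>c\<close>. In the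
  other ones \<open>x\<close> itself or its \<open>(c ^ d)\<close>-th power is separable.\<close>

lemma separable_over_multiple_of_pow:
  assumes K: "subfield K R" and x: "x \<in> carrier R" "(algebraic over K) x" "degree (Irr K x) \<le> d"
    and c: "c = 0 \<or> Factorial_Ring.prime c" and e: "c \<noteq> 0 \<Longrightarrow> e = c"
  shows "separable_over K ([\<Prod>{i\<in>{1..d}. \<not> c dvd i}] \<cdot> (x [^] (e ^ d)))"
proof -
  let ?s = "\<Prod>{i\<in>{1..d}. \<not> c dvd i}" and ?y = "x [^] (e ^ d)"
  have y: "?y \<in> carrier R"
    using x by simp
  note S = subfieldE(1)[OF subfield_of_separables[OF K]]
  have multiple: "separable_over K ([?s] \<cdot> ?y)" if "separable_over K ?y"
    using subring_add_pow_closed[OF S, of ?y ?s] y that by simp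
  consider "characteristic = 0 \<or> d < characteristic" | "characteristic = c" "characteristic \<noteq> 0"
    | "characteristic \<noteq> 0" "characteristic \<le> d" "characteristic \<noteq> c"
    by linarith
  then show ?thesis
  proof cases
    case 1
    then have "separable_over K x"
      using separable_over_if_degree_Irr_less_characteristic[OF K x(1,2)] x(3) by fastforce
    then show ?thesis
      using multiple separable_over_nat_pow[OF K x(1)] by blast
  next
    case 2
    then show ?thesis
      using multiple separable_over_characteristic_pow[OF K _ x] e by simp
  next
    case 3
    then have prime: "Factorial_Ring.prime characteristic"
      using characteristic_eq_0_or_prime by simp
    then have "\<not> c dvd characteristic"
      using c 3 primes_dvd_imp_eq by auto
    then have "characteristic dvd ?s"
      using 3 prime_gt_0_nat[OF prime]
      by (intro dvd_prodI[where f = "\<lambda>i. i"]) (auto simp: Suc_le_eq)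
    then have "[?s] \<cdot> ?y = \<zero>"
      using add_pow_eq_zero_iff[OF y] by blast
    then show ?thesis
      using subringE(2)[OF S] by simp
  qed
qed

end

lemma (in domain) pirreducible_isgcd_one_iff:
  assumes K: "subring K R" and m: "m \<in> carrier (K[X])" "pirreducible K m" and q: "q \<in> carrier (K[X])"
  shows "\<one>\<^bsub>K[X]\<^esub> gcdof\<^bsub>K[X]\<^esub> m q \<longleftrightarrow> \<not> m divides\<^bsub>K[X]\<^esub> q"
proof -
  interpret UP: domain "K[X]"
    using univ_poly_is_domain[OF K] .
  have one: "m divides\<^bsub>K[X]\<^esub> \<one>\<^bsub>K[X]\<^esub> \<Longrightarrow> False"
    using UP.divides_unit[OF _ _ UP.Units_one_closed] pirreducibleE(2)[OF K m] m(1) by blast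
  show ?thesis
  proof
    assume "\<one>\<^bsub>K[X]\<^esub> gcdof\<^bsub>K[X]\<^esub> m q"
    then show "\<not> m divides\<^bsub>K[X]\<^esub> q"
      using one UP.divides_refl[OF m(1)] m(1) unfolding isgcd_def by blast
  next
    assume ndvd: "\<not> m divides\<^bsub>K[X]\<^esub> q"
    have "y divides\<^bsub>K[X]\<^esub> \<one>\<^bsub>K[X]\<^esub>"
      if y: "y \<in> carrier (K[X])" "y divides\<^bsub>K[X]\<^esub> m" "y divides\<^bsub>K[X]\<^esub> q" for y
    proof -
      have "\<not> y \<sim>\<^bsub>K[X]\<^esub> m"
        using ndvd UP.divides_trans[OF _ y(3) m(1)] unfolding associated_def by blast
      then have "y \<in> Units (K[X])"
        using divides_pirreducible_condition[OF m(2) y(1,2)] by blast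
      then show ?thesis
        by (rule UP.unit_divides[OF _ UP.one_closed])
    qed
    then show "\<one>\<^bsub>K[X]\<^esub> gcdof\<^bsub>K[X]\<^esub> m q"
      unfolding isgcd_def using m(1) q by (auto simp: factor_def)
  qed
qed

lemma (in field) separable_algebraic_iff:
  assumes K: "subfield K R"
  shows "separable_algebraic K R \<longleftrightarrow> (\<forall>x\<in>carrier R. separable_over K x)"
proof -
  note K' = subfieldE(1)[OF K]
  have "separable_over K x \<longleftrightarrow> separable_poly R K (Irr K x)"
    if x: "x \<in> carrier R" "(algebraic over K) x" for x
    using separable_over_iff_eval_poly_deriv_Irr[OF K x] IrrE(1,2)[OF K x]
      Irr_divides_iff[OF K x poly_deriv_closed[OF K']] poly_deriv_closed[OF K']
    unfolding separable_poly_def by (simp add: pirreducible_isgcd_one_iff[OF K'])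
  then show ?thesis
    unfolding separable_algebraic_def using separable_over_imp_algebraic[OF K] by blast
qed

section \<open>Fields generated by subrings\<close>

lemma (in field) generate_field_denominator:
  assumes A: "subring A R" and "c \<in> generate_field R A"
  shows "\<exists>s\<in>A - {\<zero>}. s \<otimes> c \<in> A"
proof -
  note AE = subringE[OF A]
  note closed = subsetD[OF AE(1)] generate_field_in_carrier[OF AE(1)]
  show ?thesis
    using assms(2)
  proof (induction rule: generate_field.induct)
    case one
    then show ?case using AE(3) by (intro bexI[of _ \<one>]) auto
  next
    case (incl h)
    then show ?case using AE(3) closed(1) by (intro bexI[of _ \<one>]) auto
  next
    case (a_inv h)
    then obtain s where "s \<in> A - {\<zero>}" "s \<otimes> h \<in> A"
      by blast
    then show ?case
      using AE(5)[of "s \<otimes> h"] a_inv closed by (intro bexI[of _ s]) (auto simp: r_minus)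
  next
    case (m_inv h)
    then obtain s where s: "s \<in> A - {\<zero>}" "s \<otimes> h \<in> A"
      by blast
    then have "s \<otimes> h \<noteq> \<zero>" "s \<otimes> h \<otimes> inv h = s"
      using m_inv closed field_Units integral_iff by (auto simp: m_assoc)
    then show ?case
      using s by (intro bexI[of _ "s \<otimes> h"]) auto
  next
    case (eng_add h k)
    then obtain s t where st: "s \<in> A - {\<zero>}" "s \<otimes> h \<in> A" "t \<in> A - {\<zero>}" "t \<otimes> k \<in> A"
      by blast
    then have "s \<otimes> t \<otimes> (h \<oplus> k) = t \<otimes> (s \<otimes> h) \<oplus> s \<otimes> (t \<otimes> k)"
      using eng_add closed by (auto simp: r_distr m_ac)
    then show ?case
      using st AE(6,7) closed(1) integral_iff by (intro bexI[of _ "s \<otimes> t"]) auto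
  next
    case (eng_mult h k)
    then obtain s t where st: "s \<in> A - {\<zero>}" "s \<otimes> h \<in> A" "t \<in> A - {\<zero>}" "t \<otimes> k \<in> A"
      by blast
    then have "s \<otimes> t \<otimes> (h \<otimes> k) = (s \<otimes> h) \<otimes> (t \<otimes> k)"
      using eng_mult closed by (auto simp: m_ac)
    then show ?case
      using st AE(6) closed(1) integral_iff by (intro bexI[of _ "s \<otimes> t"]) auto
  qed
qed

lemma (in field) generate_field_subring:
  assumes A: "subring A R"
  shows "generate_field R A = {a \<otimes> inv s |a s. a \<in> A \<and> s \<in> A - {\<zero>}}" (is "_ = ?Q")
proof
  show "generate_field R A \<subseteq> ?Q"
  proof
    fix c assume c: "c \<in> generate_field R A"
    then obtain s where s: "s \<in> A - {\<zero>}" "s \<otimes> c \<in> A"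
      using generate_field_denominator[OF A] by blast
    then have "c = s \<otimes> c \<otimes> inv s"
      using c subringE(1)[OF A] generate_field_in_carrier[OF subringE(1)[OF A] c] field_Units
      by (auto simp: m_ac)
    then show "c \<in> ?Q"
      using s by blast
  qed
  show "?Q \<subseteq> generate_field R A"
    by (auto intro!: generate_field.eng_mult generate_field.m_inv intro: generate_field.incl)
qed

lemma (in field) generate_field_common_denominator:
  assumes A: "subring A R" and "set cs \<subseteq> generate_field R A"
  obtains s where "s \<in> A - {\<zero>}" "set (map ((\<otimes>) s) cs) \<subseteq> A"
proof -
  note closed = subsetD[OF subringE(1)[OF A]] generate_field_in_carrier[OF subringE(1)[OF A]]
  have "\<exists>s\<in>A - {\<zero>}. set (map ((\<otimes>) s) cs) \<subseteq> A"
    using assms(2)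
  proof (induction cs)
    case Nil
    then show ?case using subringE(3)[OF A] by (intro bexI[of _ \<one>]) auto
  next
    case (Cons c cs)
    then obtain s t where st: "s \<in> A - {\<zero>}" "s \<otimes> c \<in> A" "t \<in> A - {\<zero>}" "set (map ((\<otimes>) t) cs) \<subseteq> A"
      using generate_field_denominator[OF A] by (metis list.set_intros(1,2) subset_code(1))
    have "s \<otimes> t \<in> A - {\<zero>}"
      using st subringE(6)[OF A] closed(1) integral_iff by auto
    moreover have "s \<otimes> t \<otimes> d \<in> A" if "d \<in> set (c # cs)" for d
    proof -
      have "s \<otimes> t \<otimes> d = t \<otimes> (s \<otimes> d)" "s \<otimes> t \<otimes> d = s \<otimes> (t \<otimes> d)"
        using st Cons.prems closed that by (auto simp: m_ac)
      then show ?thesis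
        using that st subringE(6)[OF A] by (metis DiffD1 image_subset_iff list.set_map set_ConsD)
    qed
    ultimately show ?case
      by (intro bexI[of _ "s \<otimes> t"]) auto
  qed
  then show thesis
    using that by blast
qed

lemma (in field) separable_over_generate_field:
  assumes A: "subring A R" and x: "x \<in> carrier R"
  shows "separable_over (generate_field R A) x \<longleftrightarrow> separable_over A x"
proof
  note AR = subringE(1)[OF A]
  assume "separable_over (generate_field R A) x"
  then obtain f where f: "set f \<subseteq> generate_field R A" "eval f x = \<zero>" "eval (poly_deriv f) x \<noteq> \<zero>"
    unfolding separable_over_def by blast
  obtain s where s: "s \<in> A - {\<zero>}" "set (map ((\<otimes>) s) f) \<subseteq> A"
    using generate_field_common_denominator[OF A f(1)] .
  have sc: "s \<in> carrier R" "set f \<subseteq> carrier R"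
    using s(1) AR f(1) generate_field_in_carrier[OF AR] by auto
  have "eval (map ((\<otimes>) s) f) x = \<zero>" "eval (poly_deriv (map ((\<otimes>) s) f)) x \<noteq> \<zero>"
    using f s(1) eval_in_carrier[OF poly_deriv_in_carrier[OF sc(2)] x] sc(1)
    unfolding eval_smult[OF sc x] eval_poly_deriv_smult[OF sc x] by (simp_all add: integral_iff)
  then show "separable_over A x"
    unfolding separable_over_def using s(2) by blast
next
  assume "separable_over A x"
  then show "separable_over (generate_field R A) x"
    by (rule separable_over_mono) (blast intro: generate_field.incl)
qed

lemma (in field) separable_algebraic_generate_field_iff:
  assumes A: "subring A R" and B: "subring B R" "A \<subseteq> B" and gen: "generate_field R B = carrier R"
  shows "separable_algebraic (generate_field R A) R \<longleftrightarrow> (\<forall>b\<in>B. separable_over A b)"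
proof -
  let ?S = "{x \<in> carrier R. separable_over (generate_field R A) x}"
  note K = generate_field_is_subfield[OF subringE(1)[OF A]]
  have "carrier R \<subseteq> ?S \<longleftrightarrow> B \<subseteq> ?S"
    using generate_field_min_subfield1[OF subringE(1)[OF B(1)] subfield_of_separables[OF K]] gen
      subringE(1)[OF B(1)] by blast
  then show ?thesis
    using separable_algebraic_iff[OF K] separable_over_generate_field[OF A] subringE(1)[OF B(1)]
    by auto
qed

lemma (in field) purely_inseparable_generate_field:
  assumes K: "subfield K R" and B: "subring B R" and gen: "generate_field R B = carrier R"
    and pow: "\<And>b. b \<in> B \<Longrightarrow> \<exists>n::nat. b [^] (char_exponent R ^ n) \<in> K"
  shows "purely_inseparable K R"
  unfolding purely_inseparable_def
proof
  let ?e = "char_exponent R"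
  have pow_add: "b [^] (?e ^ (m + n)) \<in> K" if "b \<in> carrier R" "b [^] (?e ^ m) \<in> K" for b m n
    using subring_nat_pow_closed[OF subfieldE(1)[OF K] that(2), of "?e ^ n"] that(1)
    by (simp add: nat_pow_pow power_add)
  fix x assume "x \<in> carrier R"
  then obtain a s where as: "a \<in> B" "s \<in> B - {\<zero>}" "x = a \<otimes> inv s"
    unfolding gen[symmetric] generate_field_subring[OF B] by blast
  then have closed: "a \<in> carrier R" "s \<in> carrier R" "s \<in> Units R"
    using subringE(1)[OF B] field_Units by auto
  obtain m n where "a [^] (?e ^ m) \<in> K" "s [^] (?e ^ n) \<in> K"
    using pow as by blast
  then have mem: "a [^] (?e ^ (m + n)) \<in> K" "s [^] (?e ^ (m + n)) \<in> K"
    using pow_add[of a m n] pow_add[of s n m] closed by (simp_all add: add.commute)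
  have "s [^] (?e ^ (m + n)) \<otimes> x [^] (?e ^ (m + n)) = a [^] (?e ^ (m + n))"
    using closed as(3) by (simp add: m_ac flip: nat_pow_distrib)
  moreover have "s [^] (?e ^ (m + n)) \<noteq> \<zero>"
    using Units_pow_closed[OF closed(3)] field_Units by blast
  ultimately have "x [^] (?e ^ (m + n)) \<in> K"
    using subfield_m_inv_simprule[OF K, of "s [^] (?e ^ (m + n))"] mem \<open>x \<in> carrier R\<close> by simp
  then show "\<exists>n. x [^] (?e ^ n) \<in> K"
    by blast
qed

lemma (in ring_hom_ring) separable_over_image_iff:
  assumes A: "A \<subseteq> carrier R" and x: "x \<in> carrier R"
  shows "S.separable_over (h ` A) (h x) \<longleftrightarrow>
    (\<exists>p. set p \<subseteq> A \<and> h (R.eval p x) = \<zero>\<^bsub>S\<^esub> \<and> h (R.eval (R.poly_deriv p) x) \<noteq> \<zero>\<^bsub>S\<^esub>)"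
proof -
  have "set f \<subseteq> h ` A \<longleftrightarrow> (\<exists>p. set p \<subseteq> A \<and> f = map h p)" for f
    using lists_image[of h A] unfolding lists_eq_set by blast
  then have "S.separable_over (h ` A) (h x) \<longleftrightarrow> (\<exists>p. set p \<subseteq> A \<and>
      S.eval (map h p) (h x) = \<zero>\<^bsub>S\<^esub> \<and> S.eval (S.poly_deriv (map h p)) (h x) \<noteq> \<zero>\<^bsub>S\<^esub>)"
    unfolding S.separable_over_def by auto
  moreover have "S.eval (map h p) (h x) = h (R.eval p x)"
    "S.eval (S.poly_deriv (map h p)) (h x) = h (R.eval (R.poly_deriv p) x)" if "set p \<subseteq> A" for p
    using eval_hom'[OF x, of p] eval_poly_deriv_hom[OF x, of p] A that by auto
  then have "(\<exists>p. set p \<subseteq> A \<and>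
      S.eval (map h p) (h x) = \<zero>\<^bsub>S\<^esub> \<and> S.eval (S.poly_deriv (map h p)) (h x) \<noteq> \<zero>\<^bsub>S\<^esub>) \<longleftrightarrow>
    (\<exists>p. set p \<subseteq> A \<and> h (R.eval p x) = \<zero>\<^bsub>S\<^esub> \<and> h (R.eval (R.poly_deriv p) x) \<noteq> \<zero>\<^bsub>S\<^esub>)"
    by (simp cong: conj_cong)
  ultimately show ?thesis
    by simp
qed

lemma (in field) div_eq_div_iff:
  assumes "a \<in> carrier R" "b \<in> carrier R" "s \<in> carrier R - {\<zero>}" "t \<in> carrier R - {\<zero>}"
  shows "a \<otimes> inv s = b \<otimes> inv t \<longleftrightarrow> a \<otimes> t = b \<otimes> s"
proof -
  have units: "s \<in> Units R" "t \<in> Units R"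
    using assms field_Units by auto
  then have closed: "a \<in> carrier R" "b \<in> carrier R" "s \<in> carrier R" "t \<in> carrier R"
      "inv s \<in> carrier R" "inv t \<in> carrier R"
    using assms by auto
  have "(s \<otimes> t) \<otimes> (a \<otimes> inv s) = (a \<otimes> t) \<otimes> (s \<otimes> inv s)"
    "(s \<otimes> t) \<otimes> (b \<otimes> inv t) = (b \<otimes> s) \<otimes> (t \<otimes> inv t)"
    using closed by algebra+
  then show ?thesis
    using Units_l_cancel[of "s \<otimes> t" "a \<otimes> inv s" "b \<otimes> inv t"] units closed by simp
qed

section \<open>Localization and residue fields\<close>

lemma (in ring) subring_inclusion_hom:
  assumes "subring A R"
  shows "ring_hom_ring (R\<lparr>carrier := A\<rparr>) R id"
proof (rule ring_hom_ringI2[OF subring_is_ring[OF assms] ring_axioms])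
  show "id \<in> ring_hom (R\<lparr>carrier := A\<rparr>) R"
    using subringE(1)[OF assms] by (intro ring_hom_memI) auto
qed

context primeideal
begin

lemma one_notin: "\<one> \<notin> I"
  using I_notcarr one_imp_carrier by blast

lemma complement_mult_closed:
  "s \<in> carrier R - I \<Longrightarrow> t \<in> carrier R - I \<Longrightarrow> s \<otimes> t \<in> carrier R - I"
  using I_prime by auto

lemma one_in_complement: "\<one> \<in> carrier R - I"
  using one_notin by simp

text \<open>In this form, a function of \<open>(a, s)\<close> is well defined on fractions as soon as it takes the same
  value at \<open>(u a, u s)\<close>.\<close>

lemma fraction_rel_iff:
  "((a, s), (b, t)) \<in> fraction_rel R I \<longleftrightarrow>
    a \<in> carrier R \<and> s \<in> carrier R - I \<and> b \<in> carrier R \<and> t \<in> carrier R - I \<and>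
    (\<exists>u\<in>carrier R - I. \<exists>v\<in>carrier R - I. u \<otimes> a = v \<otimes> b \<and> u \<otimes> s = v \<otimes> t)"
proof -
  have "(\<exists>u\<in>carrier R - I. u \<otimes> (a \<otimes> t \<ominus> b \<otimes> s) = \<zero>) \<longleftrightarrow>
      (\<exists>u\<in>carrier R - I. \<exists>v\<in>carrier R - I. u \<otimes> a = v \<otimes> b \<and> u \<otimes> s = v \<otimes> t)"
    if closed: "a \<in> carrier R" "b \<in> carrier R" "s \<in> carrier R - I" "t \<in> carrier R - I"
  proof
    assume "\<exists>u\<in>carrier R - I. u \<otimes> (a \<otimes> t \<ominus> b \<otimes> s) = \<zero>"
    then obtain u where u: "u \<in> carrier R - I" "u \<otimes> (a \<otimes> t \<ominus> b \<otimes> s) = \<zero>"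
      by blast
    have "(u \<otimes> t) \<otimes> a \<ominus> (u \<otimes> s) \<otimes> b = u \<otimes> (a \<otimes> t \<ominus> b \<otimes> s)"
      using closed u(1) by (simp only: Diff_iff) algebra
    then have "(u \<otimes> t) \<otimes> a = (u \<otimes> s) \<otimes> b"
      using closed u r_right_minus_eq by auto
    moreover have "(u \<otimes> t) \<otimes> s = (u \<otimes> s) \<otimes> t"
      using closed u(1) by (simp add: m_ac)
    ultimately show "\<exists>u\<in>carrier R - I. \<exists>v\<in>carrier R - I. u \<otimes> a = v \<otimes> b \<and> u \<otimes> s = v \<otimes> t"
      using complement_mult_closed closed(3,4) u(1) by meson
  next
    assume "\<exists>u\<in>carrier R - I. \<exists>v\<in>carrier R - I. u \<otimes> a = v \<otimes> b \<and> u \<otimes> s = v \<otimes> t"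
    then obtain u v where uv: "u \<in> carrier R - I" "v \<in> carrier R - I" "u \<otimes> a = v \<otimes> b" "u \<otimes> s = v \<otimes> t"
      by blast
    have "(u \<otimes> v) \<otimes> (a \<otimes> t \<ominus> b \<otimes> s) = (u \<otimes> a) \<otimes> (v \<otimes> t) \<ominus> (v \<otimes> b) \<otimes> (u \<otimes> s)"
      using closed uv(1,2) by (simp only: Diff_iff) algebra
    also have "\<dots> = \<zero>"
      using closed uv(2) by (simp add: uv(3,4) minus_eq r_neg)
    finally show "\<exists>u\<in>carrier R - I. u \<otimes> (a \<otimes> t \<ominus> b \<otimes> s) = \<zero>"
      using complement_mult_closed[OF uv(1,2)] by blast
  qed
  then show ?thesis
    unfolding fraction_rel_def by auto
qed

lemma equiv_fraction_rel: "equiv (carrier R \<times> (carrier R - I)) (fraction_rel R I)"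
proof (rule equivI)
  show "fraction_rel R I \<subseteq> (carrier R \<times> (carrier R - I)) \<times> (carrier R \<times> (carrier R - I))"
    unfolding fraction_rel_def by auto
  show "refl_on (carrier R \<times> (carrier R - I)) (fraction_rel R I)"
    using one_in_complement unfolding refl_on_def by (auto simp: fraction_rel_iff)
  show "sym (fraction_rel R I)"
  proof (rule symI)
    fix x y assume "(x, y) \<in> fraction_rel R I"
    then show "(y, x) \<in> fraction_rel R I"
      by (cases x; cases y) (simp only: fraction_rel_iff, metis)
  qed
  show "trans (fraction_rel R I)"
  proof (rule transI)
    fix x y z assume "(x, y) \<in> fraction_rel R I" "(y, z) \<in> fraction_rel R I"
    moreover obtain a s b t c w where pairs: "x = (a, s)" "y = (b, t)" "z = (c, w)"
      by (metis surj_pair)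
    ultimately obtain u v u' v' where
      closed: "a \<in> carrier R" "s \<in> carrier R - I" "b \<in> carrier R" "t \<in> carrier R - I"
        "c \<in> carrier R" "w \<in> carrier R - I" "u \<in> carrier R - I" "v \<in> carrier R - I"
        "u' \<in> carrier R - I" "v' \<in> carrier R - I"
      and eq: "u \<otimes> a = v \<otimes> b" "u \<otimes> s = v \<otimes> t" "u' \<otimes> b = v' \<otimes> c" "u' \<otimes> t = v' \<otimes> w"
      unfolding pairs fraction_rel_iff by blast
    have "u' \<otimes> u \<otimes> a = v \<otimes> v' \<otimes> c" "u' \<otimes> u \<otimes> s = v \<otimes> v' \<otimes> w"
      using closed by (simp_all add: m_assoc eq m_lcomm[of u' v] flip: eq(3,4))
    then show "(x, z) \<in> fraction_rel R I"
      unfolding pairs fraction_rel_iff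
      using closed complement_mult_closed[of u' u] complement_mult_closed[of v v'] by blast
  qed
qed

lemma fraction_eq_iff:
  assumes "a \<in> carrier R" "s \<in> carrier R - I" "b \<in> carrier R" "t \<in> carrier R - I"
  shows "fraction R I a s = fraction R I b t \<longleftrightarrow>
    (\<exists>u\<in>carrier R - I. \<exists>v\<in>carrier R - I. u \<otimes> a = v \<otimes> b \<and> u \<otimes> s = v \<otimes> t)"
  unfolding fraction_def using assms eq_equiv_class_iff[OF equiv_fraction_rel, of "(a, s)" "(b, t)"]
  by (simp add: fraction_rel_iff)

lemma mem_fraction_iff:
  assumes "a \<in> carrier R" "s \<in> carrier R - I"
  shows "(b, t) \<in> fraction R I a s \<longleftrightarrow>
    b \<in> carrier R \<and> t \<in> carrier R - I \<and> fraction R I b t = fraction R I a s"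
  using assms fraction_eq_iff[of b t a s] unfolding fraction_def Image_singleton_iff fraction_rel_iff
  by metis

lemma fraction_scale:
  assumes "u \<in> carrier R - I" "a \<in> carrier R" "s \<in> carrier R - I"
  shows "fraction R I (u \<otimes> a) (u \<otimes> s) = fraction R I a s"
proof -
  have "\<one> \<otimes> (u \<otimes> a) = u \<otimes> a" "\<one> \<otimes> (u \<otimes> s) = u \<otimes> s"
    using assms by simp_all
  then show ?thesis
    using fraction_eq_iff[of "u \<otimes> a" "u \<otimes> s" a s] assms one_in_complement complement_mult_closed
    by blast
qed

lemma UN_fraction:
  assumes "a \<in> carrier R" "s \<in> carrier R - I" "b \<in> carrier R" "t \<in> carrier R - I"
    and scale: "\<And>a s b t u v. \<lbrakk>a \<in> carrier R; s \<in> carrier R - I; b \<in> carrier R; t \<in> carrier R - I;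
      u \<in> carrier R - I; v \<in> carrier R - I\<rbrakk> \<Longrightarrow> F (u \<otimes> a) (u \<otimes> s) (v \<otimes> b) (v \<otimes> t) = F a s b t"
  shows "(\<Union>(a', s')\<in>fraction R I a s. \<Union>(b', t')\<in>fraction R I b t. F a' s' b' t') = F a s b t"
proof -
  have eq: "F a' s' b' t' = F a s b t"
    if "(a', s') \<in> fraction R I a s" "(b', t') \<in> fraction R I b t" for a' s' b' t'
  proof -
    have closed: "a' \<in> carrier R" "s' \<in> carrier R - I" "b' \<in> carrier R" "t' \<in> carrier R - I"
      and eq: "fraction R I a' s' = fraction R I a s" "fraction R I b' t' = fraction R I b t"
      using that assms(1-4) by (simp_all add: mem_fraction_iff)
    obtain u u' v v' where scalars: "u \<in> carrier R - I" "u' \<in> carrier R - I"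
        "v \<in> carrier R - I" "v' \<in> carrier R - I"
      and "u' \<otimes> a' = u \<otimes> a" "u' \<otimes> s' = u \<otimes> s" "v' \<otimes> b' = v \<otimes> b" "v' \<otimes> t' = v \<otimes> t"
      using eq unfolding fraction_eq_iff[OF closed(1,2) assms(1,2)]
        fraction_eq_iff[OF closed(3,4) assms(3,4)]
      by blast
    then show ?thesis
      using scale[OF closed scalars(2,4)] scale[OF assms(1-4) scalars(1,3)] by simp
  qed
  have mem: "(a, s) \<in> fraction R I a s" "(b, t) \<in> fraction R I b t"
    using assms(1-4) mem_fraction_iff by simp_all
  have "(\<Union>(b', t')\<in>fraction R I b t. F a' s' b' t') = F a s b t"
    if "(a', s') \<in> fraction R I a s" for a' s'
    by (intro SUP_eq_const) (use that eq mem(2) in auto)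
  then show ?thesis
    by (intro SUP_eq_const) (use mem(1) in auto)
qed

lemma localization_carrier:
  "carrier (localization R I) = {fraction R I a s |a s. a \<in> carrier R \<and> s \<in> carrier R - I}"
  unfolding localization_def fraction_def quotient_def by auto

lemma fraction_closed:
  "a \<in> carrier R \<Longrightarrow> s \<in> carrier R - I \<Longrightarrow> fraction R I a s \<in> carrier (localization R I)"
  unfolding localization_carrier by blast

lemma localization_one: "\<one>\<^bsub>localization R I\<^esub> = fraction R I \<one> \<one>"
  and localization_zero: "\<zero>\<^bsub>localization R I\<^esub> = fraction R I \<zero> \<one>"
  unfolding localization_def by simp_all

lemma fraction_mult:
  assumes "a \<in> carrier R" "s \<in> carrier R - I" "b \<in> carrier R" "t \<in> carrier R - I"
  shows "fraction R I a s \<otimes>\<^bsub>localization R I\<^esub> fraction R I b t = fraction R I (a \<otimes> b) (s \<otimes> t)"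
proof -
  have "fraction R I ((u \<otimes> a) \<otimes> (v \<otimes> b)) ((u \<otimes> s) \<otimes> (v \<otimes> t)) = fraction R I (a \<otimes> b) (s \<otimes> t)"
    if "a \<in> carrier R" "s \<in> carrier R - I" "b \<in> carrier R" "t \<in> carrier R - I"
      "u \<in> carrier R - I" "v \<in> carrier R - I" for a s b t u v
  proof -
    have "(u \<otimes> a) \<otimes> (v \<otimes> b) = (u \<otimes> v) \<otimes> (a \<otimes> b)" "(u \<otimes> s) \<otimes> (v \<otimes> t) = (u \<otimes> v) \<otimes> (s \<otimes> t)"
      using that by (auto simp: m_ac)
    then show ?thesis
      using fraction_scale[of "u \<otimes> v" "a \<otimes> b" "s \<otimes> t"] that complement_mult_closed by simp
  qed
  then have "(\<Union>(a, s)\<in>fraction R I a s. \<Union>(b, t)\<in>fraction R I b t. fraction R I (a \<otimes> b) (s \<otimes> t)) =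
      fraction R I (a \<otimes> b) (s \<otimes> t)"
    using assms by (intro UN_fraction[where F = "\<lambda>a s b t. fraction R I (a \<otimes> b) (s \<otimes> t)"])
  then show ?thesis
    unfolding localization_def by simp
qed

lemma fraction_add:
  assumes "a \<in> carrier R" "s \<in> carrier R - I" "b \<in> carrier R" "t \<in> carrier R - I"
  shows "fraction R I a s \<oplus>\<^bsub>localization R I\<^esub> fraction R I b t =
    fraction R I (a \<otimes> t \<oplus> b \<otimes> s) (s \<otimes> t)"
proof -
  have "fraction R I ((u \<otimes> a) \<otimes> (v \<otimes> t) \<oplus> (v \<otimes> b) \<otimes> (u \<otimes> s)) ((u \<otimes> s) \<otimes> (v \<otimes> t)) =
      fraction R I (a \<otimes> t \<oplus> b \<otimes> s) (s \<otimes> t)"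
    if "a \<in> carrier R" "s \<in> carrier R - I" "b \<in> carrier R" "t \<in> carrier R - I"
      "u \<in> carrier R - I" "v \<in> carrier R - I" for a s b t u v
  proof -
    have "(u \<otimes> a) \<otimes> (v \<otimes> t) \<oplus> (v \<otimes> b) \<otimes> (u \<otimes> s) = (u \<otimes> v) \<otimes> (a \<otimes> t \<oplus> b \<otimes> s)"
        "(u \<otimes> s) \<otimes> (v \<otimes> t) = (u \<otimes> v) \<otimes> (s \<otimes> t)"
      using that by (auto simp: m_ac r_distr)
    then show ?thesis
      using fraction_scale[of "u \<otimes> v" "a \<otimes> t \<oplus> b \<otimes> s" "s \<otimes> t"] that complement_mult_closed by simp
  qed
  then have "(\<Union>(a, s)\<in>fraction R I a s. \<Union>(b, t)\<in>fraction R I b t.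
        fraction R I (a \<otimes> t \<oplus> b \<otimes> s) (s \<otimes> t)) =
      fraction R I (a \<otimes> t \<oplus> b \<otimes> s) (s \<otimes> t)"
    using assms by (intro UN_fraction[where F = "\<lambda>a s b t. fraction R I (a \<otimes> t \<oplus> b \<otimes> s) (s \<otimes> t)"])
  then show ?thesis
    unfolding localization_def by simp
qed

lemma fraction_add_same_denominator:
  assumes "a \<in> carrier R" "b \<in> carrier R" "s \<in> carrier R - I"
  shows "fraction R I a s \<oplus>\<^bsub>localization R I\<^esub> fraction R I b s = fraction R I (a \<oplus> b) s"
proof -
  have "a \<otimes> s \<oplus> b \<otimes> s = s \<otimes> (a \<oplus> b)"
    using assms by (simp add: r_distr m_comm)
  then show ?thesis
    using assms fraction_scale[of s "a \<oplus> b" s] by (simp add: fraction_add)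
qed

lemma localization_common_denominator:
  assumes "x \<in> carrier (localization R I)" "y \<in> carrier (localization R I)"
    "z \<in> carrier (localization R I)"
  obtains a b c s where "a \<in> carrier R" "b \<in> carrier R" "c \<in> carrier R" "s \<in> carrier R - I"
    "x = fraction R I a s" "y = fraction R I b s" "z = fraction R I c s"
proof -
  obtain a s b t c w where frac: "x = fraction R I a s" "y = fraction R I b t" "z = fraction R I c w"
    and closed: "a \<in> carrier R" "b \<in> carrier R" "c \<in> carrier R"
      "s \<in> carrier R - I" "t \<in> carrier R - I" "w \<in> carrier R - I"
    using assms unfolding localization_carrier by blast
  have "t \<otimes> w \<in> carrier R - I" "s \<otimes> w \<in> carrier R - I" "s \<otimes> t \<in> carrier R - I"
      "t \<otimes> w \<otimes> s \<in> carrier R - I"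
    using closed complement_mult_closed by blast+
  moreover have "s \<otimes> w \<otimes> t = t \<otimes> w \<otimes> s" "s \<otimes> t \<otimes> w = t \<otimes> w \<otimes> s"
    using closed by (auto simp: m_ac)
  ultimately show thesis
    using that[of "t \<otimes> w \<otimes> a" "s \<otimes> w \<otimes> b" "s \<otimes> t \<otimes> c" "t \<otimes> w \<otimes> s"] closed frac
      fraction_scale[of "t \<otimes> w" a s] fraction_scale[of "s \<otimes> w" b t] fraction_scale[of "s \<otimes> t" c w]
    by simp
qed

lemma localization_abelian_group: "abelian_group (localization R I)"
proof (rule abelian_groupI)
  fix x y z
  assume "x \<in> carrier (localization R I)" "y \<in> carrier (localization R I)"
    "z \<in> carrier (localization R I)"
  from localization_common_denominator[OF this]
  obtain a b c s where "a \<in> carrier R" "b \<in> carrier R" "c \<in> carrier R" "s \<in> carrier R - I"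
    "x = fraction R I a s" "y = fraction R I b s" "z = fraction R I c s" .
  then show "x \<oplus>\<^bsub>localization R I\<^esub> y \<oplus>\<^bsub>localization R I\<^esub> z =
      x \<oplus>\<^bsub>localization R I\<^esub> (y \<oplus>\<^bsub>localization R I\<^esub> z)"
    by (simp add: fraction_add_same_denominator a_assoc)
next
  fix x y
  assume "x \<in> carrier (localization R I)" "y \<in> carrier (localization R I)"
  then obtain a s b t where frac: "x = fraction R I a s" "y = fraction R I b t"
    and closed: "a \<in> carrier R" "b \<in> carrier R" "s \<in> carrier R - I" "t \<in> carrier R - I"
    unfolding localization_carrier by blast
  have "s \<otimes> t = t \<otimes> s" "a \<otimes> t \<oplus> b \<otimes> s = b \<otimes> s \<oplus> a \<otimes> t"
    using closed by (auto simp: m_comm a_comm)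
  then show "x \<oplus>\<^bsub>localization R I\<^esub> y \<in> carrier (localization R I)"
    "x \<oplus>\<^bsub>localization R I\<^esub> y = y \<oplus>\<^bsub>localization R I\<^esub> x"
    unfolding frac using closed complement_mult_closed[of t s]
    by (simp_all add: fraction_add fraction_closed)
next
  show "\<zero>\<^bsub>localization R I\<^esub> \<in> carrier (localization R I)"
    using one_in_complement by (simp add: localization_zero fraction_closed)
next
  fix x assume "x \<in> carrier (localization R I)"
  then obtain a s where x: "x = fraction R I a s" "a \<in> carrier R" "s \<in> carrier R - I"
    unfolding localization_carrier by blast
  have "\<zero>\<^bsub>localization R I\<^esub> = fraction R I \<zero> s"
    using fraction_scale[of s \<zero> \<one>] x one_in_complement by (simp add: localization_zero)
  then show "\<zero>\<^bsub>localization R I\<^esub> \<oplus>\<^bsub>localization R I\<^esub> x = x"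
    "\<exists>y\<in>carrier (localization R I). y \<oplus>\<^bsub>localization R I\<^esub> x = \<zero>\<^bsub>localization R I\<^esub>"
    using x fraction_closed[of "\<ominus> a" s] fraction_add_same_denominator[of \<zero> a s]
      fraction_add_same_denominator[of "\<ominus> a" a s] by (auto simp: l_neg)
qed

lemma localization_comm_monoid: "comm_monoid (localization R I)"
proof (rule comm_monoidI)
  fix x y z
  assume "x \<in> carrier (localization R I)" "y \<in> carrier (localization R I)"
    "z \<in> carrier (localization R I)"
  from localization_common_denominator[OF this]
  obtain a b c s where "a \<in> carrier R" "b \<in> carrier R" "c \<in> carrier R" "s \<in> carrier R - I"
    "x = fraction R I a s" "y = fraction R I b s" "z = fraction R I c s" .
  then show "x \<otimes>\<^bsub>localization R I\<^esub> y \<otimes>\<^bsub>localization R I\<^esub> z =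
      x \<otimes>\<^bsub>localization R I\<^esub> (y \<otimes>\<^bsub>localization R I\<^esub> z)"
    using complement_mult_closed[of s s] by (simp add: fraction_mult m_assoc)
next
  fix x y
  assume "x \<in> carrier (localization R I)" "y \<in> carrier (localization R I)"
  then obtain a s b t where frac: "x = fraction R I a s" "y = fraction R I b t"
    and closed: "a \<in> carrier R" "b \<in> carrier R" "s \<in> carrier R - I" "t \<in> carrier R - I"
    unfolding localization_carrier by blast
  show "x \<otimes>\<^bsub>localization R I\<^esub> y \<in> carrier (localization R I)"
    "x \<otimes>\<^bsub>localization R I\<^esub> y = y \<otimes>\<^bsub>localization R I\<^esub> x"
    unfolding frac using closed complement_mult_closed[of s t]
    by (simp_all add: fraction_mult fraction_closed m_comm)
next
  show "\<one>\<^bsub>localization R I\<^esub> \<in> carrier (localization R I)"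
    using one_in_complement by (simp add: localization_one fraction_closed)
next
  fix x assume "x \<in> carrier (localization R I)"
  then show "\<one>\<^bsub>localization R I\<^esub> \<otimes>\<^bsub>localization R I\<^esub> x = x"
    using one_in_complement unfolding localization_carrier
    by (auto simp: localization_one fraction_mult)
qed

lemma localization_cring: "cring (localization R I)"
proof (rule cringI[OF localization_abelian_group localization_comm_monoid])
  fix x y z
  assume "x \<in> carrier (localization R I)" "y \<in> carrier (localization R I)"
    "z \<in> carrier (localization R I)"
  from localization_common_denominator[OF this]
  obtain a b c s where "a \<in> carrier R" "b \<in> carrier R" "c \<in> carrier R" "s \<in> carrier R - I"
    "x = fraction R I a s" "y = fraction R I b s" "z = fraction R I c s" .
  then show "(x \<oplus>\<^bsub>localization R I\<^esub> y) \<otimes>\<^bsub>localization R I\<^esub> z =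
      x \<otimes>\<^bsub>localization R I\<^esub> z \<oplus>\<^bsub>localization R I\<^esub> y \<otimes>\<^bsub>localization R I\<^esub> z"
    using complement_mult_closed[of s s]
    by (simp add: fraction_add_same_denominator fraction_mult l_distr)
qed

interpretation L: cring "localization R I"
  by (rule localization_cring)

lemma fraction_hom: "ring_hom_ring R (localization R I) (\<lambda>a. fraction R I a \<one>)"
  using one_in_complement
  by (intro ring_hom_ringI)
    (simp_all add: ring_axioms L.ring_axioms fraction_closed fraction_mult
      fraction_add_same_denominator localization_one)

lemma fraction_uminus:
  assumes "a \<in> carrier R" "s \<in> carrier R - I"
  shows "\<ominus>\<^bsub>localization R I\<^esub> fraction R I a s = fraction R I (\<ominus> a) s"
proof (rule L.minus_equality)
  show "fraction R I (\<ominus> a) s \<oplus>\<^bsub>localization R I\<^esub> fraction R I a s = \<zero>\<^bsub>localization R I\<^esub>"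
    using assms fraction_scale[of s \<zero> \<one>] one_in_complement
    by (simp add: fraction_add_same_denominator localization_zero l_neg)
qed (use assms fraction_closed in simp_all)

lemma ideal_fractions:
  "ideal {fraction R I a s |a s. a \<in> I \<and> s \<in> carrier R - I} (localization R I)" (is "ideal ?J _")
proof (rule idealI)
  show "ring (localization R I)" ..
  have mem: "fraction R I a s \<in> ?J" if "a \<in> I" "s \<in> carrier R - I" for a s
    using that by blast
  show "subgroup ?J (add_monoid (localization R I))"
  proof (rule L.add.subgroupI)
    show "?J \<subseteq> carrier (localization R I)"
      using fraction_closed Icarr by blast
    show "?J \<noteq> {}"
      using one_in_complement additive_subgroup.zero_closed[OF is_additive_subgroup] by blast
  next
    fix x assume "x \<in> ?J"
    then show "\<ominus>\<^bsub>localization R I\<^esub> x \<in> ?J"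
      using mem fraction_uminus Icarr by auto
  next
    fix x y assume "x \<in> ?J" "y \<in> ?J"
    then obtain a s b t where "x = fraction R I a s" "y = fraction R I b t"
      "a \<in> I" "b \<in> I" "s \<in> carrier R - I" "t \<in> carrier R - I"
      by blast
    then show "x \<oplus>\<^bsub>localization R I\<^esub> y \<in> ?J"
      using mem[of "a \<otimes> t \<oplus> b \<otimes> s" "s \<otimes> t"] complement_mult_closed[of s t] I_r_closed Icarr
      by (simp add: fraction_add)
  qed
  fix x y assume "x \<in> ?J" "y \<in> carrier (localization R I)"
  then obtain a s b t where "x = fraction R I a s" "y = fraction R I b t"
    "a \<in> I" "b \<in> carrier R" "s \<in> carrier R - I" "t \<in> carrier R - I"
    unfolding localization_carrier by blast
  then show "y \<otimes>\<^bsub>localization R I\<^esub> x \<in> ?J" "x \<otimes>\<^bsub>localization R I\<^esub> y \<in> ?J"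
    using mem[of "a \<otimes> b" "s \<otimes> t"] mem[of "b \<otimes> a" "t \<otimes> s"] complement_mult_closed[of s t]
      complement_mult_closed[of t s] I_r_closed[of a b] I_l_closed[of a b] Icarr
    by (simp_all add: fraction_mult)
qed

lemma ideal_localized_ideal: "ideal (localized_ideal R I) (localization R I)"
  unfolding localized_ideal_def
  using fraction_closed Icarr one_in_complement by (intro L.genideal_ideal) blast

interpretation J: ideal "localized_ideal R I" "localization R I"
  by (rule ideal_localized_ideal)

lemma fraction_mem_localized_ideal_iff:
  assumes a: "a \<in> carrier R" and s: "s \<in> carrier R - I"
  shows "fraction R I a s \<in> localized_ideal R I \<longleftrightarrow> a \<in> I"
proof
  have "localized_ideal R I \<subseteq> {fraction R I a s |a s. a \<in> I \<and> s \<in> carrier R - I}"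
    unfolding localized_ideal_def using one_in_complement
    by (intro L.genideal_minimal[OF ideal_fractions]) blast
  moreover assume "fraction R I a s \<in> localized_ideal R I"
  ultimately obtain b t where b: "b \<in> I" "t \<in> carrier R - I" "fraction R I a s = fraction R I b t"
    by blast
  then obtain u v where "u \<in> carrier R - I" "v \<in> carrier R - I" "u \<otimes> a = v \<otimes> b"
    using fraction_eq_iff[of a s b t] a s Icarr by blast
  then show "a \<in> I"
    using I_prime[of u a] I_l_closed[OF b(1), of v] a by auto
next
  assume "a \<in> I"
  then have "fraction R I a \<one> \<in> localized_ideal R I"
    unfolding localized_ideal_def using L.genideal_self[of "(\<lambda>a. fraction R I a \<one>) ` I"]
      fraction_closed Icarr one_in_complement by blast
  moreover have "fraction R I a s = fraction R I \<one> s \<otimes>\<^bsub>localization R I\<^esub> fraction R I a \<one>"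
    using a s one_in_complement by (simp add: fraction_mult)
  ultimately show "fraction R I a s \<in> localized_ideal R I"
    using J.I_l_closed fraction_closed[of \<one> s] s by simp
qed

abbreviation residue_of_fraction :: "'a \<Rightarrow> 'a \<Rightarrow> ('a \<times> 'a) set set"
  where "residue_of_fraction a s \<equiv>
    localized_ideal R I +>\<^bsub>localization R I\<^esub> fraction R I a s"

abbreviation \<kappa> :: "('a \<times> 'a) set set ring"
  where "\<kappa> \<equiv> residue_field R I"

definition residue :: "'a \<Rightarrow> ('a \<times> 'a) set set"
  where "residue a = residue_of_fraction a \<one>"

interpretation k: cring \<kappa>
  unfolding residue_field_def by (rule J.quotient_is_cring[OF localization_cring])

interpretation coset: ring_hom_ring "localization R I" \<kappa> "(+>\<^bsub>localization R I\<^esub>) (localized_ideal R I)"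
  unfolding residue_field_def by (rule J.rcos_ring_hom_ring)

lemma residue_field_carrier:
  "carrier \<kappa> = {residue_of_fraction a s |a s. a \<in> carrier R \<and> s \<in> carrier R - I}"
  unfolding residue_field_def FactRing_def A_RCOSETS_def' localization_carrier by auto

lemma residue_hom: "ring_hom_ring R \<kappa> residue"
  using ring_hom_trans[OF ring_hom_ring.homh[OF fraction_hom] coset.homh]
  by (intro ring_hom_ringI2) (simp_all add: ring_axioms k.ring_axioms residue_def[abs_def] comp_def)

lemma residue_of_fraction_eq_zero_iff:
  assumes "a \<in> carrier R" "s \<in> carrier R - I"
  shows "residue_of_fraction a s = \<zero>\<^bsub>\<kappa>\<^esub> \<longleftrightarrow> a \<in> I"
proof -
  have "\<zero>\<^bsub>\<kappa>\<^esub> = localized_ideal R I"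
    unfolding residue_field_def FactRing_def by simp
  then show ?thesis
    using J.rcos_const_imp_mem J.a_rcos_const fraction_closed[OF assms]
      fraction_mem_localized_ideal_iff[OF assms] by metis
qed

lemma residue_eq_zero_iff: "a \<in> carrier R \<Longrightarrow> residue a = \<zero>\<^bsub>\<kappa>\<^esub> \<longleftrightarrow> a \<in> I"
  unfolding residue_def by (rule residue_of_fraction_eq_zero_iff[OF _ one_in_complement])

lemma field_residue_field: "field \<kappa>"
proof (rule k.cring_fieldI2)
  show "\<zero>\<^bsub>\<kappa>\<^esub> \<noteq> \<one>\<^bsub>\<kappa>\<^esub>"
    using residue_of_fraction_eq_zero_iff[of \<one> \<one>] coset.hom_one one_in_complement
    by (auto simp: localization_one)
next
  fix x assume "x \<in> carrier \<kappa>" "x \<noteq> \<zero>\<^bsub>\<kappa>\<^esub>"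
  then obtain a s where as: "a \<in> carrier R - I" "s \<in> carrier R - I"
    "x = residue_of_fraction a s"
    unfolding residue_field_carrier using residue_of_fraction_eq_zero_iff by blast
  have "fraction R I a s \<otimes>\<^bsub>localization R I\<^esub> fraction R I s a = \<one>\<^bsub>localization R I\<^esub>"
    using as fraction_scale[of "a \<otimes> s" \<one> \<one>] complement_mult_closed one_in_complement
    by (simp add: fraction_mult localization_one m_comm[of s a])
  then have "x \<otimes>\<^bsub>\<kappa>\<^esub> residue_of_fraction s a = \<one>\<^bsub>\<kappa>\<^esub>"
    using as coset.hom_mult[of "fraction R I a s" "fraction R I s a"] coset.hom_one
    by (simp add: fraction_closed)
  then show "\<exists>y\<in>carrier \<kappa>. x \<otimes>\<^bsub>\<kappa>\<^esub> y = \<one>\<^bsub>\<kappa>\<^esub>"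
    using as unfolding residue_field_carrier by blast
qed

interpretation k: field \<kappa>
  by (rule field_residue_field)

interpretation residue: ring_hom_ring R \<kappa> residue
  by (rule residue_hom)

lemma residue_of_fraction_eq_div:
  assumes "a \<in> carrier R" "s \<in> carrier R - I"
  shows "residue_of_fraction a s = residue a \<otimes>\<^bsub>\<kappa>\<^esub> inv\<^bsub>\<kappa>\<^esub> residue s"
proof -
  let ?x = "residue_of_fraction a s"
  have "?x \<in> carrier \<kappa>" "residue s \<in> carrier \<kappa>" "residue s \<in> Units \<kappa>"
    using assms residue_eq_zero_iff[of s] residue.hom_closed[of s]
    by (auto simp: residue_field_carrier k.field_Units)
  moreover have "residue a = ?x \<otimes>\<^bsub>\<kappa>\<^esub> residue s"
    unfolding residue_def
    using assms one_in_complement fraction_scale[of s a \<one>]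
      coset.hom_mult[of "fraction R I a s" "fraction R I s \<one>"]
    by (simp add: fraction_closed fraction_mult m_comm[of s a])
  ultimately show ?thesis
    by (simp add: k.m_assoc)
qed

lemma residue_of_fraction_eq_iff:
  assumes "a \<in> carrier R" "s \<in> carrier R - I" "b \<in> carrier R" "t \<in> carrier R - I"
  shows "residue_of_fraction a s = residue_of_fraction b t \<longleftrightarrow> a \<otimes> t \<ominus> b \<otimes> s \<in> I"
proof -
  have "residue a \<otimes>\<^bsub>\<kappa>\<^esub> inv\<^bsub>\<kappa>\<^esub> residue s = residue b \<otimes>\<^bsub>\<kappa>\<^esub> inv\<^bsub>\<kappa>\<^esub> residue t \<longleftrightarrow>
      residue a \<otimes>\<^bsub>\<kappa>\<^esub> residue t = residue b \<otimes>\<^bsub>\<kappa>\<^esub> residue s"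
    using assms residue_eq_zero_iff by (intro k.div_eq_div_iff) auto
  also have "\<dots> \<longleftrightarrow> residue (a \<otimes> t \<ominus> b \<otimes> s) = \<zero>\<^bsub>\<kappa>\<^esub>"
    using assms k.r_right_minus_eq[of "residue (a \<otimes> t)" "residue (b \<otimes> s)"]
    by (simp add: minus_eq k.minus_eq)
  finally show ?thesis
    using assms by (simp add: residue_of_fraction_eq_div residue_eq_zero_iff)
qed

lemma mem_Union_residue_of_fraction_iff:
  assumes "a \<in> carrier R" "s \<in> carrier R - I"
  shows "(b, t) \<in> \<Union> (residue_of_fraction a s) \<longleftrightarrow>
    b \<in> carrier R \<and> t \<in> carrier R - I \<and>
    residue_of_fraction b t = residue_of_fraction a s" (is "_ \<in> \<Union> ?X \<longleftrightarrow> ?rhs")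
proof
  assume "(b, t) \<in> \<Union> ?X"
  then obtain F where F: "F \<in> ?X" "(b, t) \<in> F"
    by blast
  then have "F \<in> carrier (localization R I)"
    using J.a_elemrcos_carrier[OF fraction_closed[OF assms]] by blast
  then have "b \<in> carrier R" "t \<in> carrier R - I" "F = fraction R I b t"
    using F(2) mem_fraction_iff unfolding localization_carrier by auto
  then show ?rhs
    using J.a_repr_independence'[OF F(1) fraction_closed[OF assms]] by simp
next
  assume rhs: ?rhs
  then have "fraction R I b t \<in> ?X"
    using J.a_rcos_self[OF fraction_closed, of b t] by simp
  moreover have "(b, t) \<in> fraction R I b t"
    using mem_fraction_iff rhs by simp
  ultimately show "(b, t) \<in> \<Union> ?X"
    by blast
qed

lemma generate_field_residue_image:
  assumes A: "subring A R"
  shows "generate_field \<kappa> (residue ` A) = {residue a \<otimes>\<^bsub>\<kappa>\<^esub> inv\<^bsub>\<kappa>\<^esub> residue s |a s. a \<in> A \<and> s \<in> A - I}"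
proof -
  have nonzero: "residue ` A - {\<zero>\<^bsub>\<kappa>\<^esub>} = residue ` (A - I)"
    using residue_eq_zero_iff[OF subsetD[OF subringE(1)[OF A]]] by auto
  show ?thesis
    unfolding k.generate_field_subring[OF residue.img_is_subring[OF A]] nonzero by blast
qed

lemma primeideal_Int_subring:
  assumes A: "subring A R"
  shows "primeideal (I \<inter> A) (R\<lparr>carrier := A\<rparr>)"
proof (rule primeidealI)
  have "I \<inter> A = {a \<in> carrier (R\<lparr>carrier := A\<rparr>). id a \<in> I}"
    by auto
  then show "ideal (I \<inter> A) (R\<lparr>carrier := A\<rparr>)"
    using ring_hom_ring.ideal_vimage[OF subring_inclusion_hom[OF A] ideal_axioms] by simp
  show "cring (R\<lparr>carrier := A\<rparr>)"
    using subcring_iff[OF subringE(1)[OF A]] subcringI'[OF A] by blast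
  show "carrier (R\<lparr>carrier := A\<rparr>) \<noteq> I \<inter> A"
    using subringE(3)[OF A] one_notin by auto
  show "a \<in> I \<inter> A \<or> b \<in> I \<inter> A"
    if "a \<in> carrier (R\<lparr>carrier := A\<rparr>)" "b \<in> carrier (R\<lparr>carrier := A\<rparr>)"
      "a \<otimes>\<^bsub>R\<lparr>carrier := A\<rparr>\<^esub> b \<in> I \<inter> A" for a b
    using that I_prime[of a b] subringE(1)[OF A] by auto
qed

lemma residual_map_residue_of_fraction:
  assumes A: "subring A R" and as: "a \<in> A" "s \<in> A - I"
  shows "residual_map R I (primeideal.residue_of_fraction (I \<inter> A) (R\<lparr>carrier := A\<rparr>) a s) =
    residue a \<otimes>\<^bsub>\<kappa>\<^esub> inv\<^bsub>\<kappa>\<^esub> residue s"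
proof -
  let ?A = "R\<lparr>carrier := A\<rparr>"
  note AE = subringE[OF A]
  interpret A: primeideal "I \<inter> A" ?A
    by (rule primeideal_Int_subring[OF A])
  let ?X = "A.residue_of_fraction a s"
  interpret incl: ring_hom_ring ?A R id
    by (rule subring_inclusion_hom[OF A])
  have "residue_of_fraction b t = residue a \<otimes>\<^bsub>\<kappa>\<^esub> inv\<^bsub>\<kappa>\<^esub> residue s" if "(b, t) \<in> \<Union> ?X" for b t
  proof -
    have b: "b \<in> A" "t \<in> A - I" "b \<otimes> s \<ominus>\<^bsub>?A\<^esub> a \<otimes> t \<in> I"
      using A.mem_Union_residue_of_fraction_iff[of a s b t]
        A.residue_of_fraction_eq_iff[of b t a s] as that by auto
    then have "b \<otimes> s \<ominus> a \<otimes> t \<in> I"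
      using incl.hom_a_inv[of "a \<otimes> t"] AE(6) as by (simp add: A.minus_eq minus_eq)
    then show ?thesis
      using residue_of_fraction_eq_iff[of b t a s] residue_of_fraction_eq_div[of a s] as b AE(1)
      by blast
  qed
  moreover have "(a, s) \<in> \<Union> ?X"
    using A.mem_Union_residue_of_fraction_iff[of a s a s] as by simp
  ultimately show ?thesis
    unfolding residual_map_def by (intro SUP_eq_const) auto
qed

lemma residual_subfield_eq:
  assumes A: "subring A R"
  shows "residual_subfield A R I = generate_field \<kappa> (residue ` A)"
proof -
  let ?A = "R\<lparr>carrier := A\<rparr>"
  interpret A: primeideal "I \<inter> A" ?A
    by (rule primeideal_Int_subring[OF A])
  have "residual_subfield A R I =
      {residual_map R I (A.residue_of_fraction a s) |a s. a \<in> A \<and> s \<in> A - I}"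
    unfolding residual_subfield_def A.residue_field_carrier by auto
  also have "\<dots> = {residue a \<otimes>\<^bsub>\<kappa>\<^esub> inv\<^bsub>\<kappa>\<^esub> residue s |a s. a \<in> A \<and> s \<in> A - I}"
    using residual_map_residue_of_fraction[OF A] by (simp cong: conj_cong rev_conj_cong)
  also have "\<dots> = generate_field \<kappa> (residue ` A)"
    by (rule generate_field_residue_image[OF A, symmetric])
  finally show ?thesis .
qed

lemma generate_field_residue: "generate_field \<kappa> (residue ` carrier R) = carrier \<kappa>"
proof -
  have "carrier \<kappa> = {residue a \<otimes>\<^bsub>\<kappa>\<^esub> inv\<^bsub>\<kappa>\<^esub> residue s |a s. a \<in> carrier R \<and> s \<in> carrier R - I}"
    unfolding residue_field_carrier using residue_of_fraction_eq_div
    by (simp cong: conj_cong rev_conj_cong)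
  then show ?thesis
    using generate_field_residue_image[OF carrier_is_subring] by simp
qed

lemma subfield_residual_subfield:
  assumes A: "subring A R"
  shows "subfield (residual_subfield A R I) \<kappa>"
  unfolding residual_subfield_eq[OF A]
  by (rule k.generate_field_is_subfield[OF subringE(1)[OF residue.img_is_subring[OF A]]])

lemma residue_mem_residual_subfield:
  "subring A R \<Longrightarrow> a \<in> A \<Longrightarrow> residue a \<in> residual_subfield A R I"
  unfolding residual_subfield_eq by (blast intro: generate_field.incl)

end

section \<open>Lying over\<close>

lemma (in cring) exists_maximal_ideal_disjoint:
  assumes "\<zero> \<notin> M"
  obtains P where "ideal P R" "P \<inter> M = {}"
    "\<forall>J. ideal J R \<and> J \<inter> M = {} \<and> P \<subseteq> J \<longrightarrow> J = P"
proof -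
  let ?F = "{J. ideal J R \<and> J \<inter> M = {}}"
  have "\<exists>P\<in>?F. \<forall>J\<in>?F. P \<subseteq> J \<longrightarrow> J = P"
  proof (rule subset_Zorn_nonempty)
    show "?F \<noteq> {}"
      using zeroideal assms by auto
    fix C assume C: "C \<noteq> {}" "subset.chain ?F C"
    then have "subset.chain {J. ideal J R} C"
      unfolding subset_chain_def by blast
    then have "ideal (\<Union>C) R"
      using chain_Union_is_ideal[of C] C(1) by simp
    then show "\<Union>C \<in> ?F"
      using C unfolding subset_chain_def by blast
  qed
  then obtain P where "P \<in> ?F" "\<forall>J\<in>?F. P \<subseteq> J \<longrightarrow> J = P"
    by (rule bexE)
  then show thesis
    by (intro that[of P]) auto
qed

lemma (in cring) maximal_disjoint_ideal_meets:
  assumes P: "ideal P R" and max: "\<forall>J. ideal J R \<and> J \<inter> M = {} \<and> P \<subseteq> J \<longrightarrow> J = P"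
    and a: "a \<in> carrier R - P"
  obtains q r where "q \<in> P" "r \<in> carrier R" "q \<oplus> r \<otimes> a \<in> M"
proof -
  interpret P: ideal P R by (rule P)
  let ?J = "P <+>\<^bsub>R\<^esub> PIdl a"
  have J: "ideal ?J R"
    using add_ideals[OF P cgenideal_ideal] a by simp
  have mem: "q \<oplus> r \<otimes> a \<in> ?J" if "q \<in> P" "r \<in> carrier R" for q r
    using that unfolding set_add_def' cgenideal_def by blast
  have "P \<subseteq> ?J" "a \<in> ?J"
    using mem[of _ \<zero>] mem[of \<zero> \<one>] a P.Icarr additive_subgroup.zero_closed[OF P.is_additive_subgroup]
    by auto
  then have "?J \<inter> M \<noteq> {}"
    using max J a by blast
  then show thesis
    using that unfolding set_add_def' cgenideal_def by blast
qed

lemma (in cring) primeideal_if_maximal_disjoint: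
  assumes P: "ideal P R" "P \<inter> M = {}"
    and max: "\<forall>J. ideal J R \<and> J \<inter> M = {} \<and> P \<subseteq> J \<longrightarrow> J = P"
    and M: "\<one> \<in> M" "\<And>a b. a \<in> M \<Longrightarrow> b \<in> M \<Longrightarrow> a \<otimes> b \<in> M"
  shows "primeideal P R"
proof (rule primeidealI[OF P(1) is_cring])
  interpret P: ideal P R by (rule P(1))
  show "carrier R \<noteq> P"
    using M(1) P(2) by blast
  fix a b assume ab: "a \<in> carrier R" "b \<in> carrier R" "a \<otimes> b \<in> P"
  show "a \<in> P \<or> b \<in> P"
  proof (rule ccontr)
    assume "\<not> (a \<in> P \<or> b \<in> P)"
    then have "a \<in> carrier R - P" "b \<in> carrier R - P"
      using ab by simp_all
    note meets = maximal_disjoint_ideal_meets[OF P(1) max this(1)]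
      maximal_disjoint_ideal_meets[OF P(1) max this(2)]
    obtain q r where qr: "q \<in> P" "r \<in> carrier R" "q \<oplus> r \<otimes> a \<in> M"
      by (rule meets(1))
    obtain q' r' where qr': "q' \<in> P" "r' \<in> carrier R" "q' \<oplus> r' \<otimes> b \<in> M"
      by (rule meets(2))
    note closed = qr(2) qr'(2) P.Icarr[OF qr(1)] P.Icarr[OF qr'(1)] ab(1,2)
    have "(q \<oplus> r \<otimes> a) \<otimes> (q' \<oplus> r' \<otimes> b) =
        q \<otimes> (q' \<oplus> r' \<otimes> b) \<oplus> ((r \<otimes> a) \<otimes> q' \<oplus> (r \<otimes> r') \<otimes> (a \<otimes> b))"
      using closed by algebra
    also have "\<dots> \<in> P"
      using closed P.I_r_closed[OF qr(1)] P.I_l_closed[OF qr'(1)] P.I_l_closed[OF ab(3)]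
      by (intro additive_subgroup.a_closed[OF P.is_additive_subgroup]) simp_all
    finally show False
      using M(2)[OF qr(3) qr'(3)] P(2) by blast
  qed
qed

lemma (in ideal) eval_diff_mem:
  assumes "set p \<subseteq> carrier R" "x \<in> carrier R" "y \<in> carrier R" "x \<ominus> y \<in> I"
  shows "eval p x \<ominus> eval p y \<in> I"
proof -
  interpret coset: ring_hom_ring R "R Quot I" "(+>) I"
    by (rule rcos_ring_hom_ring)
  have "I +> x = I +> y"
    using quotient_eq_iff_same_a_r_cos[OF ideal_axioms] assms by blast
  then have "I +> eval p x = I +> eval p y"
    using assms by (simp add: coset.eval_hom')
  then show ?thesis
    using quotient_eq_iff_same_a_r_cos[OF ideal_axioms] eval_in_carrier assms by blast
qed

lemma (in ring) eval_in_subring: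
  assumes "subring T R" "set p \<subseteq> T" "x \<in> T"
  shows "eval p x \<in> T"
  using ring.eval_in_carrier[OF subring_is_ring[OF assms(1)], of p x] assms
  by (simp add: eval_consistent[OF assms(1)])

lemma (in primeideal) complement_nat_pow_closed:
  "s \<in> carrier R - I \<Longrightarrow> s [^] (n::nat) \<in> carrier R - I"
  by (induction n) (use one_in_complement complement_mult_closed in auto)

primrec (in ring) scale_roots :: "'a \<Rightarrow> 'a list \<Rightarrow> 'a list"
  where "scale_roots a [] = []"
  | "scale_roots a (c # p) = c # map ((\<otimes>) a) (scale_roots a p)"

lemma (in ring) length_scale_roots [simp]: "length (scale_roots a p) = length p"
  by (induction p) auto

lemma (in ring) scale_roots_in_subring:
  assumes "subring T R" "a \<in> T" "set p \<subseteq> T"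
  shows "set (scale_roots a p) \<subseteq> T"
  using assms(3) by (induction p) (use assms(2) subringE(6)[OF assms(1)] in auto)

lemma (in cring) eval_scale_roots:
  assumes a: "a \<in> carrier R" and y: "y \<in> carrier R" and "set p \<subseteq> carrier R"
  shows "eval (scale_roots a p) (a \<otimes> y) = a [^] degree p \<otimes> eval p y"
  using assms(3)
proof (induction p)
  case Nil
  then show ?case by simp
next
  case (Cons c p)
  have p: "set p \<subseteq> carrier R" "c \<in> carrier R" "eval p y \<in> carrier R"
    using Cons.prems eval_in_carrier y by auto
  note q = scale_roots_in_subring[OF carrier_is_subring a p(1)]
  have "eval (map ((\<otimes>) a) (scale_roots a p)) (a \<otimes> y) = a \<otimes> (a [^] degree p \<otimes> eval p y)"
    using Cons.IH[OF p(1)] eval_smult[OF a q] a y by simp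
  also have "\<dots> = a [^] length p \<otimes> eval p y"
    using a p(3) by (cases p) (simp_all add: m_assoc[symmetric] nat_pow_comm m_comm)
  finally show ?case
    using a y p by (simp add: nat_pow_distrib r_distr m_ac)
qed

lemma (in cring) exists_scaled_monic_root:
  assumes T: "subring T R" and int: "integral_extension T R" and a: "a \<in> T" and y: "y \<in> carrier R"
  obtains g where "set g \<subseteq> T" "eval (\<one> # map ((\<otimes>) a) g) (a \<otimes> y) = \<zero>"
proof -
  obtain p where "set p \<subseteq> T" "p \<noteq> []" "lead_coeff p = \<one>" "eval p y = \<zero>"
    using int y unfolding integral_extension_def by blast
  then obtain l where l: "set l \<subseteq> T" "eval (\<one> # l) y = \<zero>"
    by (cases p) auto
  have "a \<in> carrier R" "set (\<one> # l) \<subseteq> carrier R"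
    using a l(1) subringE(1)[OF T] by auto
  then have "eval (scale_roots a (\<one> # l)) (a \<otimes> y) = \<zero>"
    using eval_scale_roots[of a y "\<one> # l"] y l(2) by (simp del: eval.simps scale_roots.simps)
  then show thesis
    using that[of "scale_roots a l"] scale_roots_in_subring[OF T a l(1)] by simp
qed

lemma (in primeideal) eval_monic_notin:
  assumes s: "s \<in> carrier R - I" and a: "a \<in> I" and g: "set g \<subseteq> carrier R"
  shows "eval (\<one> # map ((\<otimes>) a) g) s \<notin> I"
proof
  let ?h = "eval (\<one> # map ((\<otimes>) a) g) s" and ?e = "eval g s"
  have closed: "?e \<in> carrier R" "s [^] length g \<in> carrier R" "a \<otimes> ?e \<in> I" "a \<in> carrier R"
    using eval_in_carrier[OF g] s I_r_closed[OF a] Icarr[OF a] by auto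
  have "?h = s [^] length g \<oplus> a \<otimes> ?e"
    using s g closed by (simp add: eval_smult)
  then have "?h \<oplus> \<ominus> (a \<otimes> ?e) = s [^] length g"
    using closed by (simp add: a_assoc r_neg)
  moreover assume "?h \<in> I"
  then have "?h \<oplus> \<ominus> (a \<otimes> ?e) \<in> I"
    using closed(3) is_additive_subgroup
    by (intro additive_subgroup.a_closed additive_subgroup.a_inv_closed)
  ultimately show False
    using complement_nat_pow_closed[OF s, of "length g"] by (simp del: eval.simps)
qed

text \<open>If \<open>Q\<close> is maximal among the ideals disjoint from \<open>T - Q'\<close> and \<open>a \<in> Q'\<close> is not in \<open>Q\<close>, then
  \<open>s = q + y a\<close> for some \<open>s \<in> T - Q'\<close>, \<open>q \<in> Q\<close> and \<open>y\<close>. Scaling the roots of an integral equation of \<open>y\<close>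
  by \<open>a\<close> gives a polynomial \<open>f\<close> over \<open>T\<close> with \<open>f(s) \<in> Q \<inter> T \<subseteq> Q'\<close>, while \<open>f(s)\<close> is congruent to a
  power of \<open>s\<close> modulo \<open>Q'\<close>.\<close>

lemma (in cring) lying_over:
  assumes T: "subring T R" and int: "integral_extension T R"
    and Q': "primeideal Q' (R\<lparr>carrier := T\<rparr>)"
  obtains Q where "primeideal Q R" "Q \<inter> T = Q'"
proof -
  interpret Q': primeideal Q' "R\<lparr>carrier := T\<rparr>" by (rule Q')
  note TE = subringE[OF T]
  have Q'T: "Q' \<subseteq> T"
    using Q'.Icarr by auto
  have "\<zero> \<notin> T - Q'"
    using additive_subgroup.zero_closed[OF Q'.is_additive_subgroup] by simp
  then obtain Q where Q: "ideal Q R" "Q \<inter> (T - Q') = {}"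
    and max: "\<forall>J. ideal J R \<and> J \<inter> (T - Q') = {} \<and> Q \<subseteq> J \<longrightarrow> J = Q"
    by (rule exists_maximal_ideal_disjoint)
  interpret Q: ideal Q R by (rule Q(1))
  have prime: "primeideal Q R"
    using primeideal_if_maximal_disjoint[OF Q max] Q'.one_in_complement Q'.complement_mult_closed
    by simp
  have "a \<in> Q" if a: "a \<in> Q'" for a
  proof (rule ccontr)
    assume "a \<notin> Q"
    have aT: "a \<in> T" "a \<in> carrier R"
      using a Q'T TE(1) by auto
    then obtain q y where q: "q \<in> Q" "y \<in> carrier R" "q \<oplus> y \<otimes> a \<in> T - Q'"
      using maximal_disjoint_ideal_meets[OF Q(1) max] \<open>a \<notin> Q\<close> by blast
    define s where "s = q \<oplus> y \<otimes> a"
    have s: "s \<in> T - Q'" "s \<in> carrier R"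
      using q TE(1) by (auto simp: s_def)
    obtain g where g: "set g \<subseteq> T" "eval (\<one> # map ((\<otimes>) a) g) (a \<otimes> y) = \<zero>"
      using exists_scaled_monic_root[OF T int aT(1) q(2)] .
    define f where "f = \<one> # map ((\<otimes>) a) g"
    have f: "set f \<subseteq> T" "set f \<subseteq> carrier R"
      using g(1) TE(1,3,6) aT(1) by (auto simp: f_def)
    have "s \<ominus> a \<otimes> y = q"
      using aT(2) q(2) Q.Icarr[OF q(1)] by (simp add: s_def minus_eq m_comm a_assoc r_neg)
    then have "eval f s \<in> Q"
      using Q.eval_diff_mem[OF f(2) s(2), of "a \<otimes> y"] q(1,2) aT(2) eval_in_carrier[OF f(2) s(2)] g(2)
      by (simp add: minus_eq flip: f_def)
    then have "eval f s \<in> Q'"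
      using Q(2) eval_in_subring[OF T f(1)] s(1) by blast
    then show False
      using Q'.eval_monic_notin[of s a g] s(1) a g(1) by (simp add: eval_consistent[OF T] f_def)
  qed
  then have "Q \<inter> T = Q'"
    using Q(2) Q'T by blast
  then show thesis
    using that prime by blast
qed

section \<open>Residual separability\<close>

lemma (in ring_hom_ring) subring_vimage:
  assumes "subring K S"
  shows "subring {x \<in> carrier R. h x \<in> K} R"
  using subringE[OF assms] by (intro R.subringI) auto

definition (in ring) separable_at :: "'a set \<Rightarrow> 'a set \<Rightarrow> 'a \<Rightarrow> bool"
  where "separable_at A P x \<longleftrightarrow>
    (\<exists>p. set p \<subseteq> A \<and> eval p x \<in> P \<and> eval (poly_deriv p) x \<notin> P)"

lemma (in ring) separable_at_subring:
  assumes W: "subring W R" "A \<subseteq> W" and x: "x \<in> W"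
  shows "ring.separable_at (R\<lparr>carrier := W\<rparr>) A (P \<inter> W) x \<longleftrightarrow> separable_at A P x"
proof -
  interpret W: ring "R\<lparr>carrier := W\<rparr>"
    by (rule subring_is_ring[OF W(1)])
  interpret incl: ring_hom_ring "R\<lparr>carrier := W\<rparr>" R id
    by (rule subring_inclusion_hom[OF W(1)])
  have "W.eval p x = eval p x" "W.eval (W.poly_deriv p) x = eval (poly_deriv p) x"
    "eval p x \<in> W" "eval (poly_deriv p) x \<in> W" if "set p \<subseteq> A" for p
  proof -
    have p: "set p \<subseteq> W"
      using that W(2) by blast
    show "W.eval p x = eval p x" "W.eval (W.poly_deriv p) x = eval (poly_deriv p) x"
      using incl.eval_hom'[of x p] incl.eval_poly_deriv_hom[of x p] p x by simp_all
    show "eval p x \<in> W" "eval (poly_deriv p) x \<in> W"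
      using eval_in_subring[OF W(1) _ x] p polynomial_incl[OF poly_deriv_polynomial[OF W(1) p]]
      by auto
  qed
  then show ?thesis
    unfolding W.separable_at_def separable_at_def by auto
qed

definition (in ring) kappa_separable_closure :: "'a set \<Rightarrow> 'a set"
  where "kappa_separable_closure A = {x \<in> carrier R. \<forall>Q. primeideal Q R \<longrightarrow> separable_at A Q x}"

context primeideal
begin

interpretation k: field \<kappa>
  by (rule field_residue_field)

interpretation residue: ring_hom_ring R \<kappa> residue
  by (rule residue_hom)

lemma separable_at_iff_image:
  assumes A: "A \<subseteq> carrier R" and x: "x \<in> carrier R"
  shows "separable_at A I x \<longleftrightarrow> ring.separable_over \<kappa> (residue ` A) (residue x)"
proof -
  have "eval p x \<in> carrier R" "eval (poly_deriv p) x \<in> carrier R" if "set p \<subseteq> A" for p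
    using eval_in_carrier[OF _ x] poly_deriv_in_carrier that A by auto
  then show ?thesis
    unfolding residue.separable_over_image_iff[OF A x] separable_at_def
    by (simp add: residue_eq_zero_iff cong: conj_cong)
qed

lemma separable_at_iff_residue:
  assumes A: "subring A R" and x: "x \<in> carrier R"
  shows "separable_at A I x \<longleftrightarrow> ring.separable_over \<kappa> (residual_subfield A R I) (residue x)"
  unfolding separable_at_iff_image[OF subringE(1)[OF A] x] residual_subfield_eq[OF A]
  using k.separable_over_generate_field[OF residue.img_is_subring[OF A]] x by simp

lemma separable_algebraic_residual_iff:
  assumes A: "subring A R"
  shows "separable_algebraic (residual_subfield A R I) \<kappa> \<longleftrightarrow> (\<forall>x\<in>carrier R. separable_at A I x)"
  using k.separable_algebraic_generate_field_iff[OF residue.img_is_subring[OF A]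
      residue.img_is_subring[OF carrier_is_subring] image_mono[OF subringE(1)[OF A]]
      generate_field_residue]
    separable_at_iff_image[OF subringE(1)[OF A]]
  by (simp add: residual_subfield_eq[OF A])

lemma subring_separable_at:
  assumes A: "subring A R"
  shows "subring {x \<in> carrier R. separable_at A I x} R"
proof -
  have "{x \<in> carrier R. separable_at A I x} = {x \<in> carrier R. residue x \<in>
      {\<xi> \<in> carrier \<kappa>. k.separable_over (residual_subfield A R I) \<xi>}}"
    using separable_at_iff_residue[OF A] by auto
  then show ?thesis
    using residue.subring_vimage[OF subfieldE(1)[OF k.subfield_of_separables]]
      subfield_residual_subfield[OF A] by simp
qed

lemma separable_at_self:
  assumes "subring A R" "a \<in> A"
  shows "separable_at A I a"
  using k.separable_over_self[OF subfieldE(1)[OF subfield_residual_subfield[OF assms(1)]]]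
    residue_mem_residual_subfield[OF assms] separable_at_iff_residue[OF assms(1)]
    subringE(1)[OF assms(1)] assms(2) by auto

lemma separable_at_multiple_of_pow:
  assumes A: "subring A R" and x: "x \<in> carrier R"
    and p: "set p \<subseteq> A" "p \<noteq> []" "lead_coeff p = \<one>" "eval p x = \<zero>"
    and c: "c = 0 \<or> Factorial_Ring.prime c" and e: "c \<noteq> 0 \<Longrightarrow> e = c"
  shows "separable_at A I ([\<Prod>{i\<in>{1..degree p}. \<not> c dvd i}] \<cdot> (x [^] (e ^ degree p)))"
proof -
  let ?K = "residual_subfield A R I" and ?f = "map residue p"
  note K = subfield_residual_subfield[OF A]
  have pc: "set p \<subseteq> carrier R"
    using p(1) subringE(1)[OF A] by blast
  have "polynomial\<^bsub>\<kappa>\<^esub> ?K ?f"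
    using p residue_mem_residual_subfield[OF A] subringE(3)[OF subfieldE(1)[OF K]]
    by (cases p) (auto simp: polynomial_def)
  then have f: "?f \<in> carrier (?K[X]\<^bsub>\<kappa>\<^esub>)" "?f \<noteq> []" "k.eval ?f (residue x) = \<zero>\<^bsub>\<kappa>\<^esub>"
    using p(2,4) residue.eval_hom'[OF x pc] by (simp_all add: univ_poly_carrier)
  have rx: "residue x \<in> carrier \<kappa>"
    using x by simp
  have "k.separable_over ?K ([\<Prod>{i\<in>{1..degree p}. \<not> c dvd i}] \<cdot>\<^bsub>\<kappa>\<^esub> (residue x [^]\<^bsub>\<kappa>\<^esub> (e ^ degree p)))"
    using k.separable_over_multiple_of_pow[OF K rx k.algebraicI[OF f] _ c e]
      k.degree_Irr_le[OF K rx f] by simp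
  then show ?thesis
    using separable_at_iff_residue[OF A] x
    by (simp add: residue.hom_add_pow_nat residue.hom_nat_pow)
qed

lemma residue_pow_mem_residual_subfield:
  assumes A: "subring A R" and int: "integral_extension A R"
    and Z: "subring Z R" "kappa_separable_closure A \<subseteq> Z" and x: "x \<in> carrier R"
  shows "\<exists>n. residue x [^]\<^bsub>\<kappa>\<^esub> (char_exponent \<kappa> ^ n) \<in> residual_subfield Z R I"
proof -
  let ?c = k.characteristic and ?e = "char_exponent \<kappa>" and ?K = "residual_subfield Z R I"
  note K = subfield_residual_subfield[OF Z(1)]
  obtain p where p: "set p \<subseteq> A" "p \<noteq> []" "lead_coeff p = \<one>" "eval p x = \<zero>"
    using int x unfolding integral_extension_def by blast
  define s where "s = \<Prod>{i\<in>{1..degree p}. \<not> ?c dvd i}"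
  define y where "y = x [^] (?e ^ degree p)"
  have y: "y \<in> carrier R" "residue y \<in> carrier \<kappa>"
    using x by (simp_all add: y_def)
  have "[s] \<cdot> y \<in> kappa_separable_closure A"
    using primeideal.separable_at_multiple_of_pow[OF _ A x p k.characteristic_eq_0_or_prime, of _ ?e] y
    unfolding kappa_separable_closure_def s_def y_def k.char_exponent_eq by simp
  then have "residue ([s] \<cdot> y) \<in> ?K"
    using residue_mem_residual_subfield[OF Z(1)] Z(2) by blast
  then have mem: "[s] \<cdot>\<^bsub>\<kappa>\<^esub> \<one>\<^bsub>\<kappa>\<^esub> \<otimes>\<^bsub>\<kappa>\<^esub> residue y \<in> ?K"
    using y by (simp add: residue.hom_add_pow_nat k.add_pow_ldistr)
  have "\<not> ?c dvd s"
  proof (cases "?c = 0")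
    case False
    then show ?thesis
      using k.characteristic_eq_0_or_prime unfolding s_def by (subst prime_dvd_prod_iff) auto
  qed (auto simp: s_def)
  then have "[s] \<cdot>\<^bsub>\<kappa>\<^esub> \<one>\<^bsub>\<kappa>\<^esub> \<in> ?K - {\<zero>\<^bsub>\<kappa>\<^esub>}"
    using k.add_pow_one_eq_zero_iff[of s] k.subring_add_pow_closed[OF subfieldE(1)[OF K]]
      subringE(3)[OF subfieldE(1)[OF K]] by simp
  then have "residue y \<in> ?K"
    using k.subfield_m_inv_simprule[OF K _ y(2) mem] by blast
  then show ?thesis
    unfolding y_def using x by (auto simp: residue.hom_nat_pow)
qed

lemma purely_inseparable_residual:
  assumes "subring A R" "integral_extension A R" "subring Z R" "kappa_separable_closure A \<subseteq> Z"
  shows "purely_inseparable (residual_subfield Z R I) \<kappa>"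
  using residue_pow_mem_residual_subfield[OF assms]
  by (intro k.purely_inseparable_generate_field[OF subfield_residual_subfield[OF assms(3)]
        residue.img_is_subring[OF carrier_is_subring] generate_field_residue]) auto

end

section \<open>The greatest \<kappa>-separable subalgebra\<close>

lemma (in cring) subring_kappa_separable_closure:
  assumes "subring A R"
  shows "subring (kappa_separable_closure A) R"
  using subringE[OF primeideal.subring_separable_at[OF _ assms]]
  unfolding kappa_separable_closure_def by (intro subringI) auto

lemma (in cring) subset_kappa_separable_closure:
  assumes "subring A R"
  shows "A \<subseteq> kappa_separable_closure A"
  using primeideal.separable_at_self[OF _ assms] subringE(1)[OF assms]
  unfolding kappa_separable_closure_def by auto

lemma (in ring) integral_extension_subring:
  assumes "subring W R" "A \<subseteq> W" "integral_extension A R"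
  shows "integral_extension A (R\<lparr>carrier := W\<rparr>)"
  using assms(3) subringE(1)[OF assms(1)] eval_consistent[OF assms(1)]
  unfolding integral_extension_def by auto

lemma integral_extension_mono:
  "integral_extension R S \<Longrightarrow> R \<subseteq> W \<Longrightarrow> integral_extension W S"
  unfolding integral_extension_def by blast

lemma (in cring) kappa_separable_iff:
  assumes A: "subring A R" and W: "subring W R" "A \<subseteq> W" and int: "integral_extension A R"
  shows "kappa_separable A (R\<lparr>carrier := W\<rparr>) \<longleftrightarrow> W \<subseteq> kappa_separable_closure A"
proof -
  let ?W = "R\<lparr>carrier := W\<rparr>"
  interpret W: ring ?W
    by (rule subring_is_ring[OF W(1)])
  have AW: "subring A ?W"
    using A W ring.subring_iff[OF W.ring_axioms, of A] subring_iff[OF subringE(1)[OF A]] by simp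
  have "kappa_separable A ?W \<longleftrightarrow> (\<forall>Q'. primeideal Q' ?W \<longrightarrow> (\<forall>x\<in>W. W.separable_at A Q' x))"
    unfolding kappa_separable_def using integral_extension_subring[OF W int]
      primeideal.separable_algebraic_residual_iff[OF _ AW] by auto
  also have "\<dots> \<longleftrightarrow> (\<forall>Q. primeideal Q R \<longrightarrow> (\<forall>x\<in>W. separable_at A Q x))"
  proof (intro iffI allI impI ballI)
    fix Q x assume "\<forall>Q'. primeideal Q' ?W \<longrightarrow> (\<forall>x\<in>W. W.separable_at A Q' x)"
      and "primeideal Q R" "x \<in> W"
    then show "separable_at A Q x"
      using primeideal.primeideal_Int_subring[OF _ W(1), of Q] separable_at_subring[OF W, of x Q]
      by blast
  next
    fix Q' x assume sep: "\<forall>Q. primeideal Q R \<longrightarrow> (\<forall>x\<in>W. separable_at A Q x)"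
      and Q': "primeideal Q' ?W" and x: "x \<in> W"
    obtain Q where "primeideal Q R" "Q \<inter> W = Q'"
      using lying_over[OF W(1) integral_extension_mono[OF int W(2)] Q'] .
    then show "W.separable_at A Q' x"
      using sep x separable_at_subring[OF W, of x Q] by blast
  qed
  also have "\<dots> \<longleftrightarrow> W \<subseteq> kappa_separable_closure A"
    using subringE(1)[OF W(1)] unfolding kappa_separable_closure_def by blast
  finally show ?thesis .
qed

lemma (in cring) kappa_radicial_if_kappa_separable_closure_subset:
  assumes A: "subring A R" "integral_extension A R"
    and Z: "subring Z R" "kappa_separable_closure A \<subseteq> Z"
  shows "kappa_radicial Z R"
  using primeideal.purely_inseparable_residual[OF _ A Z] integral_extension_mono[OF A(2)]
    subset_kappa_separable_closure[OF A(1)] Z(2) unfolding kappa_radicial_def by blast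

lemma (in cring) mem_subalgebras_iff: "T \<in> subalgebras A R \<longleftrightarrow> subring T R \<and> A \<subseteq> T"
  unfolding subalgebras_def using subcringI' subcring.axioms(1) by auto

lemma (in cring) subalgebras_subring:
  assumes V: "subring V R"
  shows "subalgebras A (R\<lparr>carrier := V\<rparr>) = {U \<in> subalgebras A R. U \<subseteq> V}"
proof -
  interpret V: ring "R\<lparr>carrier := V\<rparr>"
    by (rule subring_is_ring[OF V])
  have "subcring U (R\<lparr>carrier := V\<rparr>) \<longleftrightarrow> subcring U R \<and> U \<subseteq> V" for U
    using V.subcring_iff[of U] subcring_iff[of U] subcringE(1)[of U "R\<lparr>carrier := V\<rparr>"]
      subcringE(1)[of U R] subringE(1)[OF V] by auto
  then show ?thesis
    unfolding subalgebras_def by auto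
qed

theorem theorem4p12:
  fixes S :: "('a, 'b) ring_scheme" and R :: "'a set"
  assumes "cring S"
    and "subcring R S"
    and "R \<subset> carrier S"
    and "integral_extension R S"
    and "FCP R S"
  shows "\<exists>V \<in> subalgebras R S.
      kappa_separable R (S\<lparr>carrier := V\<rparr>) \<and>
      (\<forall>W \<in> subalgebras R S. kappa_separable R (S\<lparr>carrier := W\<rparr>) \<longrightarrow> W \<subseteq> V) \<and>
      (\<forall>U \<in> subalgebras R S.
        kappa_separable R (S\<lparr>carrier := U\<rparr>) \<longleftrightarrow> U \<in> subalgebras R (S\<lparr>carrier := V\<rparr>)) \<and>
      (\<forall>Z \<in> subalgebras V S. kappa_radicial Z S)"
proof -
  interpret S: cring S by fact
  let ?V = "S.kappa_separable_closure R"
  have R: "subring R S"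
    using assms(2) by (rule subcring.axioms(1))
  have V: "subring ?V S" "?V \<in> subalgebras R S"
    using S.subring_kappa_separable_closure[OF R] S.subset_kappa_separable_closure[OF R]
    by (simp_all add: S.mem_subalgebras_iff)
  have sep: "kappa_separable R (S\<lparr>carrier := W\<rparr>) \<longleftrightarrow> W \<subseteq> ?V" if "W \<in> subalgebras R S" for W
    using that S.kappa_separable_iff[OF R _ _ assms(4)] by (simp add: S.mem_subalgebras_iff)
  have "kappa_radicial Z S" if "Z \<in> subalgebras ?V S" for Z
    using that S.kappa_radicial_if_kappa_separable_closure_subset[OF R assms(4)]
    by (simp add: S.mem_subalgebras_iff)
  then show ?thesis
    using V(2) sep by (auto simp: S.subalgebras_subring[OF V(1)] intro!: bexI[of _ ?V])
qed

end
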